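(* Let $d>2$ and let $A\subset\mathbb{Z}^m$ be a nondefective configuration with Gale dual $B\subset\mathbb{Z}^d$ and reduced discriminant $D_B\subset(\mathbb{C}^\times)^d$. Let $L$ be a non-splitting flat of $\mathcal{H}_B$. Then the stratum $\mathscr{P}^\infty_L(D_B)$ is the prism over the closed coamoeba of $D_{B|_L}$; that is, $\mathscr{P}^\infty_L(D_B)=\mathrm{pr}^{-1}\bigl(\overline{c\mathscr{A}(D_{B|_L})}\bigr)$. When $\dim L>1$, this set has dimension $d$.
   Context: $\mathbb{T}\subset\mathbb{C}$ is the unit circle; $\mathrm{Arg}$ is coordinatewise $z\mapsto z/|z|$; the coamoeba of a subset $X$ of a torus is $c\mathscr{A}(X)=\mathrm{Arg}(X)$, and its closed coamoeba is the closure. Dimension is that of subanalytic subsets of $\mathbb{T}^d$. Configurations: $A\subset\mathbb{Z}^m$ is a multiset of $n=m+d$ vectors that spans $\mathbb{Z}^m$ as a group and lies on an affine hyperplane $\{a:\langle u,a\rangle=1\}$. The kernel of $\mathbb{Z}^A\to\mathbb{Z}^m$, $(c_a)\mapsto\sum c_a a$, is free of rank $d$; an isomorphism $\mathbb{Z}^d\to$ kernel has the form $y\mapsto(\langle b_a,y\rangle)_{a\in A}$, and $B=\{b_a\}\subset M:=\mathbb{Z}^d$ is a Gale dual of $A$. It spans $M$ and has sum zero. It is assumed that $A$ is not a pyramid, i.e. all elements of $B$ are nonzero. Let $Y_A=\{(x^a)_{a\in A}:x\in(\mathbb{C}^\times)^m\}\subset\mathbb{C}^A$ and let $X_A^*$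 be the closure of the set of hyperplanes (in the dual space of $\mathbb{C}^A$) that contain a tangent space of $Y_A$. $A$ is nondefective if $X^*_A$ is a hypersurface. Discriminants: for a lattice $M'$ and a multiset $B'$ of nonzero vectors spanning $M'$, let $\mathcal{H}_{B'}$ be the central arrangement in $\mathrm{Hom}(M',\mathbb{C})$ defined by $B'$, $\lambda_{B'}(y)=(\langle b,y\rangle)_{b\in B'}$, $\mathcal{H}^c_{B'}=\lambda_{B'}(\mathrm{Hom}(M',\mathbb{C})\smallsetminus\mathcal{H}_{B'})\subset(\mathbb{C}^\times)^{B'}$, $\varphi_{B'}\colon(\mathbb{C}^\times)^{B'}\to M'\otimes_{\mathbb{Z}}\mathbb{C}^\times$, $(z_b)\mapsto\prod_b z_b^b$ (with $t^b=b\otimes t$; for $M'=\mathbb{Z}^d$, $t^b=(t^{b_1},\dots,t^{b_d})$), and $D_{B'}$ the closure of $\varphi_{B'}(\mathcal{H}^c_{B'})$. $\varphi_B$ also denotes the induced map $\mathbb{T}^B\to\mathbb{T}^d$. Flats: a flat of $\mathcal{H}_B$ is an intersection $L$ of its hyperplanes; it corresponds to the flat $F=\{b\in B:b|_L\equiv0\}$ of $B$; put $F^c=B\smallsetminus F$. A non-splitting flag is a complete flag of flats $\emptyset=F_0\subsetneq F_1\subsetneq\dots\subsetneq F_{d-1}\subsetneq B$ of $B$ (with $F_j$ of rank $j$) such that for each $j=1,\dots,d-1$ the vector $\sum_{b\in F_j}b$ does not lie in the linear span of $F_{j-1}$. A flat $L$ of $\mathcal{H}_B$ is non-splitting if its corresponding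 flat of $B$ is one of the $F_1,\dots,F_{d-1}$ of some non-splitting flag. Strata: $(\mathcal{H}/L)^c\subset(\mathbb{C}^\times)^F$ is the image of the complement in $\mathbb{C}^d/L$ of the arrangement defined by $F$ under $v\mapsto(\langle b,v\rangle)_{b\in F}$, and $(\mathcal{H}|_L)^c\subset(\mathbb{C}^\times)^{F^c}$ is the image of the complement in $L$ of the arrangement defined by $F^c$ under $v\mapsto(\langle b,v\rangle)_{b\in F^c}$. Put $\mathrm{in}_L\mathcal{H}^c_B=(\mathcal{H}/L)^c\times(\mathcal{H}|_L)^c\subset(\mathbb{C}^\times)^B$, and let $\mathscr{P}^\infty_L(D_B)$ be the closure of $c\mathscr{A}(\varphi_B(\mathrm{in}_L\mathcal{H}_B^c))$ in $\mathbb{T}^d$. Restriction: $L^\perp\subset M$ is the saturation of the $\mathbb{Z}$-span of $F$; $B|_L$ is the image of $F^c$ in $M/L^\perp$ (a spanning multiset of nonzero vectors), so $D_{B|_L}\subset(M/L^\perp)\otimes\mathbb{C}^\times$; $\mathrm{pr}\colon\mathbb{T}^d=M\otimes\mathbb{T}\to(M/L^\perp)\otimes\mathbb{T}$ is the quotient map. *)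

theory Defs
  imports "HOL-Analysis.Analysis"
begin

(* Conventions.  A multiset of lattice vectors is a family indexed by a finite type 'n, and a
   sub-multiset is the restriction of that family to an index set I.  Points of
   (C^x)^I are extensional functions on I; points of the tori (C^x)^d and T^d are vectors. *)

definition pairing :: "int ^ 'd \<Rightarrow> 'a::comm_ring_1 ^ 'd \<Rightarrow> 'a" where
  "pairing b y = (\<Sum>j\<in>UNIV. of_int (b $ j) * y $ j)"

definition zspan :: "'n::finite set \<Rightarrow> ('n \<Rightarrow> int ^ 'd) \<Rightarrow> (int ^ 'd) set" where
  "zspan I B = {(\<Sum>i\<in>I. c i *s B i) |c. True}"

definition configuration :: "('n::finite \<Rightarrow> int ^ 'm) \<Rightarrow> bool" where
  "configuration A \<longleftrightarrow> zspan UNIV A = UNIV \<and> (\<exists>u::real ^ 'm. \<forall>i. pairing (A i) u = 1)"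

definition relations :: "('n::finite \<Rightarrow> int ^ 'm) \<Rightarrow> (int ^ 'n) set" where
  "relations A = {c. (\<Sum>i\<in>UNIV. c $ i *s A i) = 0}"

definition gale_dual :: "('n::finite \<Rightarrow> int ^ 'm) \<Rightarrow> ('n \<Rightarrow> int ^ 'd) \<Rightarrow> bool" where
  "gale_dual A B \<longleftrightarrow> bij_betw (\<lambda>y::int ^ 'd. \<chi> i. pairing (B i) y) UNIV (relations A)"

definition ctorus :: "(complex ^ 'd) set" where
  "ctorus = {z. \<forall>j. z $ j \<noteq> 0}"

definition utorus :: "(complex ^ 'd) set" where
  "utorus = {t. \<forall>j. cmod (t $ j) = 1}"

definition arg_map :: "complex ^ 'd \<Rightarrow> complex ^ 'd" where
  "arg_map z = (\<chi> j. z $ j / of_real (cmod (z $ j)))"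

definition coamoeba :: "(complex ^ 'd) set \<Rightarrow> (complex ^ 'd) set" where
  "coamoeba X = arg_map ` X"

(* T^d is compact, so the closure in complex^'d is the closure in T^d. *)
definition closed_coamoeba :: "(complex ^ 'd) set \<Rightarrow> (complex ^ 'd) set" where
  "closed_coamoeba X = closure (coamoeba X)"

definition toric_set :: "('n::finite \<Rightarrow> int ^ 'm) \<Rightarrow> (complex ^ 'n) set" where
  "toric_set A = (\<lambda>x. \<chi> i. \<Prod>j\<in>UNIV. (x $ j) powi (A i $ j)) ` ctorus"

(* Velocities at y of curves in Y; for a submanifold Y this is its tangent space at y. *)
definition tangent_space :: "(complex ^ 'n::finite) set \<Rightarrow> complex ^ 'n \<Rightarrow> (complex ^ 'n) set" where
  "tangent_space Y y = {v. \<exists>\<gamma>::real \<Rightarrow> complex ^ 'n.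
     \<gamma> 0 = y \<and> range \<gamma> \<subseteq> Y \<and> (\<gamma> has_vector_derivative v) (at 0)}"

(* A hyperplane {z. (SUM i. c $ i * z $ i) = 0} is represented by its coefficient vectors
   c \<noteq> 0, so dual_variety A is the affine cone, in the dual space, over the projective X_A^*.
   The toric set Y_A is stable under scaling (A lies on an affine hyperplane), hence its
   embedded tangent spaces pass through the origin.  The closure of this constructible
   set is the same in the Euclidean and in the Zariski topology. *)
definition dual_variety :: "('n::finite \<Rightarrow> int ^ 'm) \<Rightarrow> (complex ^ 'n) set" where
  "dual_variety A = closure {c. c \<noteq> 0 \<and>
     (\<exists>y\<in>toric_set A. \<forall>v\<in>tangent_space (toric_set A) y. (\<Sum>i\<in>UNIV. c $ i * v $ i) = 0)}"

definition polynomial_fun :: "(complex ^ 'n::finite \<Rightarrow> complex) \<Rightarrow> bool" where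
  "polynomial_fun p \<longleftrightarrow> (\<exists>(E::('n \<Rightarrow> nat) set) c. finite E \<and>
     p = (\<lambda>x. \<Sum>e\<in>E. c e * (\<Prod>i\<in>UNIV. (x $ i) ^ e i)))"

definition hypersurface :: "(complex ^ 'n::finite) set \<Rightarrow> bool" where
  "hypersurface S \<longleftrightarrow> (\<exists>p. polynomial_fun p \<and> \<not> p constant_on UNIV \<and> S = {x. p x = 0})"

definition nondefective :: "('n::finite \<Rightarrow> int ^ 'm) \<Rightarrow> bool" where
  "nondefective A \<longleftrightarrow> hypersurface (dual_variety A)"

(* Image under v |-> (<b,v>)_{b in I} of the complement in V of the arrangement defined by I. *)
definition arr_compl :: "'n::finite set \<Rightarrow> ('n \<Rightarrow> int ^ 'd) \<Rightarrow> (complex ^ 'd) set \<Rightarrow> ('n \<Rightarrow> complex) set"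
  where
  "arr_compl I B V = (\<lambda>y. \<lambda>i\<in>I. pairing (B i) y) ` {y\<in>V. \<forall>i\<in>I. pairing (B i) y \<noteq> 0}"

definition phi :: "'n::finite set \<Rightarrow> ('n \<Rightarrow> int ^ 'd) \<Rightarrow> ('n \<Rightarrow> complex) \<Rightarrow> complex ^ 'd" where
  "phi I B z = (\<chi> j. \<Prod>i\<in>I. z i powi (B i $ j))"

(* Closure in the complex torus; the image is constructible, so the Euclidean closure is
   also the Zariski closure. *)
definition reduced_discriminant :: "'n::finite set \<Rightarrow> ('n \<Rightarrow> int ^ 'd) \<Rightarrow> (complex ^ 'd) set" where
  "reduced_discriminant I B = closure (phi I B ` arr_compl I B UNIV) \<inter> ctorus"

definition arr_flat :: "('n::finite \<Rightarrow> int ^ 'd) \<Rightarrow> (complex ^ 'd) set \<Rightarrow> bool" where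
  "arr_flat B L \<longleftrightarrow> (\<exists>S. L = (\<Inter>i\<in>S. {y. pairing (B i) y = 0}))"

definition vec_flat :: "('n::finite \<Rightarrow> int ^ 'd) \<Rightarrow> (complex ^ 'd) set \<Rightarrow> 'n set" where
  "vec_flat B L = {i. \<forall>y\<in>L. pairing (B i) y = 0}"

definition real_vec :: "int ^ 'd \<Rightarrow> real ^ 'd" where
  "real_vec b = (\<chi> j. of_int (b $ j))"

definition nonsplitting_flag :: "('n::finite \<Rightarrow> int ^ 'd) \<Rightarrow> (nat \<Rightarrow> 'n set) \<Rightarrow> bool" where
  "nonsplitting_flag B F \<longleftrightarrow>
     F 0 = {} \<and> F CARD('d) = UNIV \<and>
     (\<forall>j<CARD('d). F j \<subset> F (Suc j)) \<and>
     (\<forall>j<CARD('d). \<exists>L. arr_flat B L \<and> F j = vec_flat B L) \<and>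
     (\<forall>j<CARD('d). dim ((real_vec \<circ> B) ` F j) = j) \<and>
     (\<forall>j\<in>{1..<CARD('d)}. real_vec (\<Sum>i\<in>F j. B i) \<notin> span ((real_vec \<circ> B) ` F (j - 1)))"

definition nonsplitting_flat :: "('n::finite \<Rightarrow> int ^ 'd) \<Rightarrow> (complex ^ 'd) set \<Rightarrow> bool" where
  "nonsplitting_flat B L \<longleftrightarrow> arr_flat B L \<and>
     (\<exists>F. nonsplitting_flag B F \<and> (\<exists>j\<in>{1..<CARD('d)}. vec_flat B L = F j))"

(* The functionals indexed by vec_flat B L vanish on L, so on the quotient C^d/L they may be
   evaluated on representatives; the first factor is therefore (H/L)^c. *)
definition initial_compl :: "('n::finite \<Rightarrow> int ^ 'd) \<Rightarrow> (complex ^ 'd) set \<Rightarrow> ('n \<Rightarrow> complex) set" where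
  "initial_compl B L = {z. restrict z (vec_flat B L) \<in> arr_compl (vec_flat B L) B UNIV \<and>
     restrict z (- vec_flat B L) \<in> arr_compl (- vec_flat B L) B L}"

definition phase_stratum :: "('n::finite \<Rightarrow> int ^ 'd) \<Rightarrow> (complex ^ 'd) set \<Rightarrow> (complex ^ 'd) set" where
  "phase_stratum B L = closed_coamoeba (phi UNIV B ` initial_compl B L)"

definition saturation :: "(int ^ 'd) set \<Rightarrow> (int ^ 'd) set" where
  "saturation N = {x. \<exists>k::int. k \<noteq> 0 \<and> k *s x \<in> N}"

definition flat_perp :: "('n::finite \<Rightarrow> int ^ 'd) \<Rightarrow> (complex ^ 'd) set \<Rightarrow> (int ^ 'd) set" where
  "flat_perp B L = saturation (zspan (vec_flat B L) B)"

(* q is the quotient map of Z^d by N, followed by an identification of Z^d/N with Z^k. *)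
definition lattice_quotient :: "(int ^ 'd \<Rightarrow> int ^ 'k) \<Rightarrow> (int ^ 'd) set \<Rightarrow> bool" where
  "lattice_quotient q N \<longleftrightarrow> (\<forall>x y. q (x + y) = q x + q y) \<and> surj q \<and> {x. q x = 0} = N"

(* The map q tensored with the identity: e_j \<otimes> t goes to q e_j \<otimes> t. *)
definition torus_map :: "(int ^ 'd::finite \<Rightarrow> int ^ 'k) \<Rightarrow> complex ^ 'd \<Rightarrow> complex ^ 'k" where
  "torus_map q t = (\<chi> l. \<Prod>j\<in>UNIV. (t $ j) powi (q (axis j 1) $ l))"

definition real_analytic_on :: "(real ^ 'd) set \<Rightarrow> (real ^ 'd \<Rightarrow> real ^ 'd) \<Rightarrow> bool" where
  "real_analytic_on W f \<longleftrightarrow> (\<forall>p\<in>W. \<exists>r>0. \<exists>c :: ('d \<Rightarrow> nat) \<Rightarrow> real ^ 'd. \<forall>x\<in>ball p r \<inter> W.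
     ((\<lambda>e. (\<Prod>j\<in>UNIV. (x $ j - p $ j) ^ e j) *\<^sub>R c e) has_sum f x) UNIV)"

definition torus_exp :: "real ^ 'd \<Rightarrow> complex ^ 'd" where
  "torus_exp \<theta> = (\<chi> j. cis (\<theta> $ j))"

(* X contains a (nonempty) k-dimensional real-analytic submanifold of T^d.  Locally such a
   submanifold is the image of an open piece of a k-dimensional linear space V under an
   analytic diffeomorphism f between open subsets of R^d, followed by the analytic covering
   torus_exp : R^d -> T^d. *)
definition contains_submanifold :: "(complex ^ 'd) set \<Rightarrow> nat \<Rightarrow> bool" where
  "contains_submanifold X k \<longleftrightarrow> (\<exists>(V::(real ^ 'd) set) W f.
     subspace V \<and> dim V = k \<and> open W \<and> V \<inter> W \<noteq> {} \<and> real_analytic_on W f \<and> inj_on f W \<and>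
     (\<forall>x\<in>W. \<exists>f'. (f has_derivative f') (at x) \<and> inj f') \<and>
     torus_exp ` f ` (V \<inter> W) \<subseteq> X)"

(* For subanalytic X: the largest dimension of a submanifold contained in X.  The maximum is
   over a set bounded by CARD('d), which is nonempty when X meets T^d. *)
definition torus_dim :: "(complex ^ 'd) set \<Rightarrow> nat" where
  "torus_dim X = Max {k. contains_submanifold X k}"

end

theory Submission
  imports Defs
begin

text \<open>
Write \<open>F\<close> for the set of vectors that vanish on \<open>L\<close>, and \<open>F = F\<^sub>j\<close> in a non-splitting flag. Every
point of \<open>T\<^sup>d\<close> is \<open>exp (i x)\<close> for a real vector \<open>x\<close>, and the argument of \<open>\<Prod> z\<^sub>b\<^sup>b\<close> is
\<open>exp (i \<Sum> (arg z\<^sub>b) b)\<close>, so everything can be computed with exponents. The fibres of \<open>pr\<close> are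
the cosets of the torus \<open>K = exp (i span F)\<close> (\<open>torus_map_fibre\<close>; the point is that the quotient map
splits over the integers), and the restriction of the arrangement to \<open>L\<close> is the arrangement of
the images of the vectors outside \<open>F\<close> in the quotient lattice (\<open>restricted_arrangement\<close>). Hence
\<open>pr\<close> maps the stratum into the closed coamoeba of \<open>D\<^bsub>B|L\<^esub>\<close>, and by compactness the stratum is the
full prism as soon as it is closed under multiplication by \<open>K\<close>.

This closure property comes from degenerating along the flag. Choose vectors \<open>v\<^sub>0, v\<^sub>1, \<dots>\<close> such
that \<open>v\<^sub>i\<close> is orthogonal to \<open>F\<^sub>i\<close> but to no vector of \<open>F\<^sub>i\<^sub>+\<^sub>1 - F\<^sub>i\<close>. On the curve
\<open>\<Sum>\<^bsub>i<m\<^esub> R\<^sup>i t\<^sub>i v\<^sub>i + R\<^sup>m y\<close>, with \<open>R \<rightarrow> \<infinity>\<close>, \<open>|t\<^sub>i| = 1\<close> and \<open>y\<close> a point of the flat of \<open>F\<^sub>m\<close>, the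
linear form of a vector in \<open>F\<^sub>i\<^sub>+\<^sub>1 - F\<^sub>i\<close> is dominated by its \<open>t\<^sub>i v\<^sub>i\<close> term. For the vectors outside
\<open>F\<^sub>j\<close> this remains true on the tail \<open>i \<ge> j\<close> of the sum, which lies in \<open>L\<close>. The limit of the phases therefore contains the factor \<open>\<Prod> t\<^sub>i\<^bsup>\<beta>\<^sub>i\<^esup>\<close>, where \<open>\<beta>\<^sub>i\<close> is the sum of the vectors in
\<open>F\<^sub>i\<^sub>+\<^sub>1 - F\<^sub>i\<close>. The flag is non-splitting precisely when \<open>\<beta>\<^sub>i\<close> is not in \<open>span F\<^sub>i\<close>, for \<open>i < d - 1\<close>,
so \<open>\<beta>\<^sub>0, \<dots>, \<beta>\<^bsub>m-1\<^esub>\<close> form a basis of \<open>span F\<^sub>m\<close> and these factors sweep out all of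
\<open>exp (i span F\<^sub>m)\<close>. The outcome is \<open>prism_in_stratum\<close>, which holds for every \<open>m\<close> with
\<open>j \<le> m < d\<close>; the case \<open>m = j\<close> gives the prism.

For the dimension take \<open>m = d - 2 \<ge> j\<close>. Modulo \<open>span F\<^bsub>d-2\<^esub>\<close> the exponents live in a plane, and
\<open>y = v\<^bsub>d-2\<^esub> + z v\<^bsub>d-1\<^esub>\<close> traces the coamoeba of a rational plane curve when \<open>z\<close> runs through the upper
half plane. In the coordinates given by \<open>v\<^bsub>d-2\<^esub>\<close> and \<open>v\<^bsub>d-1\<^esub>\<close> the logarithmic derivatives
\<open>g\<^sub>1, g\<^sub>2\<close> of this curve satisfy \<open>g\<^sub>1 = - z g\<^sub>2\<close>, because the vectors of \<open>B\<close> sum to zero (the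
logarithmic Gauss map inverts the Horn-Kapranov parametrization). So the Jacobian of the phases is
\<open>(Im z) |g\<^sub>2|\<^sup>2\<close> up to sign, and it is nonzero somewhere because the flag does not split at \<open>F\<^bsub>d-1\<^esub>\<close>
(\<open>line_phases_have_interior\<close>). Hence the stratum contains an open subset of \<open>T\<^sup>d\<close>.
\<close>

section \<open>Phases as exponentials of real vectors\<close>

abbreviation rspan :: "('n::finite \<Rightarrow> int ^ 'd) \<Rightarrow> 'n set \<Rightarrow> (real ^ 'd) set" where
  "rspan B I \<equiv> span ((real_vec \<circ> B) ` I)"

lemma real_vec_nth [simp]: "real_vec b $ j = of_int (b $ j)"
  by (simp add: real_vec_def)

lemma torus_exp_nth [simp]: "torus_exp x $ j = cis (x $ j)"
  by (simp add: torus_exp_def)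

lemma torus_exp_add: "torus_exp (x + y) = torus_exp x * torus_exp y"
  by (simp add: vec_eq_iff cis_mult)

lemma torus_exp_in_utorus: "torus_exp x \<in> utorus"
  by (simp add: utorus_def)

lemma utorus_eq_range_torus_exp: "utorus = range torus_exp"
proof -
  have "t = torus_exp (\<chi> j. Arg (t $ j))" if "t \<in> utorus" for t :: "complex ^ 'a"
  proof -
    have "t $ j = cis (Arg (t $ j))" for j
    proof -
      have 1: "cmod (t $ j) = 1" using that by (simp add: utorus_def)
      then have "t $ j \<noteq> 0" by auto
      then show ?thesis using 1 by (simp add: cis_Arg sgn_div_norm)
    qed
    then show ?thesis by (simp add: vec_eq_iff)
  qed
  then show ?thesis by (auto simp: torus_exp_in_utorus)
qed

lemma cis_eq_iff: "cis a = cis b \<longleftrightarrow> (\<exists>n::int. a = b + 2 * pi * n)"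
  using sin_cos_eq_iff[of a b] by (auto simp: complex_eq_iff)

lemma torus_exp_eq_iff:
  "torus_exp x = torus_exp y \<longleftrightarrow> (\<exists>n. x = y + (2 * pi) *\<^sub>R real_vec n)"
proof
  assume "torus_exp x = torus_exp y"
  then have "\<forall>j. \<exists>n::int. x $ j = y $ j + 2 * pi * n"
    by (simp add: vec_eq_iff cis_eq_iff)
  then obtain n :: "'a \<Rightarrow> int" where "\<forall>j. x $ j = y $ j + 2 * pi * n j" by metis
  then show "\<exists>n. x = y + (2 * pi) *\<^sub>R real_vec n"
    by (intro exI[of _ "\<chi> j. n j"]) (simp add: vec_eq_iff)
qed (auto simp: vec_eq_iff cis_eq_iff)

lemma cis_sum: "finite I \<Longrightarrow> cis (\<Sum>i\<in>I. f i) = (\<Prod>i\<in>I. cis (f i))"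
  by (induction I rule: finite_induct) (auto simp flip: cis_mult)

lemma sgn_powi: "sgn (z powi n) = sgn z powi n" for z :: complex
proof -
  have "sgn (w ^ k) = sgn w ^ k" for w :: complex and k
    by (induction k) (auto simp: sgn_mult)
  then show ?thesis by (simp add: power_int_def sgn_inverse)
qed

lemma sgn_prod: "sgn (\<Prod>i\<in>I. f i) = (\<Prod>i\<in>I. sgn (f i))" for f :: "_ \<Rightarrow> complex"
  by (induction I rule: infinite_finite_induct) (auto simp: sgn_mult)

lemma arg_map_nth: "arg_map z $ j = sgn (z $ j)"
  by (simp add: arg_map_def sgn_div_norm scaleR_conv_of_real divide_inverse mult.commute)

lemma arg_map_phi: "arg_map (phi I B z) = phi I B (\<lambda>i. sgn (z i))"
  by (simp add: vec_eq_iff arg_map_nth phi_def sgn_prod sgn_powi)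

lemma phi_cong: "(\<And>i. i \<in> I \<Longrightarrow> z i = w i) \<Longrightarrow> phi I B z = phi I B w"
  by (auto simp: phi_def vec_eq_iff intro!: prod.cong)

lemma arg_map_phi_torus_exp:
  assumes "\<And>i. i \<in> I \<Longrightarrow> sgn (z i) = cis (\<theta> i)"
  shows "arg_map (phi I B z) = torus_exp (\<Sum>i\<in>I. \<theta> i *\<^sub>R real_vec (B i))"
proof -
  have "arg_map (phi I B z) = phi I B (\<lambda>i. cis (\<theta> i))"
    unfolding arg_map_phi by (rule phi_cong) (use assms in auto)
  then show ?thesis
    by (simp add: phi_def vec_eq_iff cis_power_int cis_sum mult.commute)
qed

lemma phi_in_ctorus: "(\<And>i. i \<in> I \<Longrightarrow> z i \<noteq> 0) \<Longrightarrow> phi I B z \<in> ctorus"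
  by (auto simp: phi_def ctorus_def)

section \<open>The pairing\<close>

lemma pairing_add_left: "pairing (a + b) y = pairing a y + pairing b y"
  by (simp add: pairing_def distrib_right sum.distrib)

lemma pairing_scale_left: "pairing (c *s b) y = of_int c * pairing b y"
  by (simp add: pairing_def sum_distrib_left mult.assoc)

lemma pairing_0_left [simp]: "pairing 0 y = 0"
  by (simp add: pairing_def)

lemma pairing_sum_left: "pairing (\<Sum>i\<in>I. f i) y = (\<Sum>i\<in>I. pairing (f i) y)"
  by (induction I rule: infinite_finite_induct) (auto simp: pairing_add_left)

lemma pairing_add_right: "pairing b (y + z) = pairing b y + pairing b z"
  by (simp add: pairing_def distrib_left sum.distrib)

lemma pairing_scale_right: "pairing b (c *s y) = c * pairing b y"
  by (simp add: pairing_def sum_distrib_left mult_ac)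

lemma pairing_0_right [simp]: "pairing b 0 = 0"
  by (simp add: pairing_def)

lemma pairing_sum_right: "pairing b (\<Sum>i\<in>I. f i) = (\<Sum>i\<in>I. pairing b (f i))"
  by (induction I rule: infinite_finite_induct) (auto simp: pairing_add_right)

definition complexify :: "real ^ 'd \<Rightarrow> complex ^ 'd" where
  "complexify v = (\<chi> j. of_real (v $ j))"

lemma pairing_complexify: "pairing b (complexify v) = of_real (real_vec b \<bullet> v)"
  by (simp add: pairing_def complexify_def inner_vec_def)

lemma Re_pairing: "Re (pairing b y) = real_vec b \<bullet> (\<chi> j. Re (y $ j))"
  by (simp add: pairing_def inner_vec_def)

lemma Im_pairing: "Im (pairing b y) = real_vec b \<bullet> (\<chi> j. Im (y $ j))"
  by (simp add: pairing_def inner_vec_def)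

lemma real_vec_scale: "real_vec (c *s a) = of_int c *\<^sub>R real_vec a"
  by (simp add: vec_eq_iff)

lemma real_vec_sum: "real_vec (\<Sum>i\<in>I. f i) = (\<Sum>i\<in>I. real_vec (f i))"
  by (simp add: vec_eq_iff)

lemma arr_flat_memI:
  assumes "arr_flat B L" "\<And>i. i \<in> vec_flat B L \<Longrightarrow> pairing (B i) y = 0"
  shows "y \<in> L"
proof -
  obtain S where S: "L = (\<Inter>i\<in>S. {y. pairing (B i) y = 0})"
    using assms(1) by (auto simp: arr_flat_def)
  then have "S \<subseteq> vec_flat B L" by (auto simp: vec_flat_def)
  then show ?thesis using assms(2) S by auto
qed

section \<open>Degenerating along a flag\<close>

text \<open>A polynomial in \<open>R\<close> has the phase of its leading coefficient in the limit \<open>R \<rightarrow> \<infinity>\<close>. The lower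
summation bound is free because the two factors of the initial complement are reached by
polynomials that start at different exponents.\<close>

lemma leading_term_sgn:
  fixes a :: "nat \<Rightarrow> complex"
  assumes "lo \<le> l" "l \<le> m" "a l \<noteq> 0" "\<And>i. l < i \<Longrightarrow> i \<le> m \<Longrightarrow> a i = 0"
  defines "p \<equiv> \<lambda>R::real. \<Sum>i=lo..m. of_real (R ^ i) * a i"
  shows "((\<lambda>R. sgn (p R)) \<longlongrightarrow> sgn (a l)) at_top"
    and "eventually (\<lambda>R. p R \<noteq> 0) at_top"
proof -
  have lim: "((\<lambda>R. \<Sum>i=lo..m. of_real (R ^ i / R ^ l) * a i) \<longlongrightarrow>
      (\<Sum>i=lo..m. if i = l then a i else 0)) at_top"
  proof (rule tendsto_sum)
    fix i assume i: "i \<in> {lo..m}"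
    consider "i < l" | "i = l" | "i > l" by linarith
    then show "((\<lambda>R. of_real (R ^ i / R ^ l) * a i) \<longlongrightarrow> (if i = l then a i else 0)) at_top"
    proof cases
      case 1
      have "((\<lambda>R::real. inverse R ^ (l - i)) \<longlongrightarrow> 0 ^ (l - i)) at_top"
        by (intro tendsto_intros tendsto_inverse_0_at_top filterlim_ident)
      moreover have "eventually (\<lambda>R::real. inverse R ^ (l - i) = R ^ i / R ^ l) at_top"
        using eventually_gt_at_top[of 0]
      proof eventually_elim
        case (elim R)
        have "R ^ l = R ^ i * R ^ (l - i)" using 1 by (simp flip: power_add)
        then show ?case using elim by (simp add: field_simps)
      qed
      ultimately have "((\<lambda>R::real. R ^ i / R ^ l) \<longlongrightarrow> 0 ^ (l - i)) at_top"
        by (rule Lim_transform_eventually)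
      then have "((\<lambda>R::real. of_real (R ^ i / R ^ l) * a i) \<longlongrightarrow> of_real 0 * a i) at_top"
        using 1 by (intro tendsto_intros) (simp add: zero_power)
      then show ?thesis using 1 by simp
    next
      case 2
      have "eventually (\<lambda>R::real. a i = of_real (R ^ i / R ^ l) * a i) at_top"
        using eventually_gt_at_top[of 0] by eventually_elim (use 2 in simp)
      then have "((\<lambda>R::real. of_real (R ^ i / R ^ l) * a i) \<longlongrightarrow> a i) at_top"
        by (rule Lim_transform_eventually[OF tendsto_const])
      then show ?thesis using 2 by simp
    next
      case 3
      then show ?thesis using assms(4)[of i] i by simp
    qed
  qed
  have "(\<Sum>i=lo..m. if i = l then a i else 0) = a l"
    using assms(1,2) by simp
  moreover have scaled: "eventually (\<lambda>R::real. (\<Sum>i=lo..m. of_real (R ^ i / R ^ l) * a i) =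
      inverse (R ^ l) *\<^sub>R p R \<and> R > 0) at_top"
    using eventually_gt_at_top[of 0]
    by eventually_elim
      (simp add: p_def scaleR_conv_of_real sum_distrib_left divide_inverse mult_ac)
  ultimately have lim': "((\<lambda>R::real. inverse (R ^ l) *\<^sub>R p R) \<longlongrightarrow> a l) at_top"
    using Lim_transform_eventually[OF lim] by (smt (verit) eventually_mono)
  have "((\<lambda>R::real. sgn (inverse (R ^ l) *\<^sub>R p R)) \<longlongrightarrow> sgn (a l)) at_top"
    by (intro tendsto_intros lim' assms)
  moreover have "eventually (\<lambda>R::real. sgn (inverse (R ^ l) *\<^sub>R p R) = sgn (p R)) at_top"
    using eventually_gt_at_top[of 0] by eventually_elim (simp add: sgn_scaleR)
  ultimately show "((\<lambda>R. sgn (p R)) \<longlongrightarrow> sgn (a l)) at_top"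
    by (rule Lim_transform_eventually)
  have "eventually (\<lambda>R::real. inverse (R ^ l) *\<^sub>R p R \<noteq> 0) at_top"
    by (rule tendsto_imp_eventually_ne[OF lim' assms(3)])
  then show "eventually (\<lambda>R. p R \<noteq> 0) at_top"
    by eventually_elim auto
qed

lemma closed_phase_stratum: "closed (phase_stratum B L)"
  by (simp add: phase_stratum_def closed_coamoeba_def)

text \<open>One curve through both factors of the initial complement: the forms of \<open>vec_flat B L\<close>, which have
level below \<open>j\<close>, are evaluated on \<open>\<Sum>\<^bsub>l\<le>m\<^esub> R\<^sup>l u\<^sub>l\<close>, and the other forms on the tail
\<open>\<Sum>\<^bsub>j\<le>l\<le>m\<^esub> R\<^sup>l u\<^sub>l\<close>, which lies in \<open>L\<close>. In both cases the term at the level of the form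
dominates.\<close>

lemma degeneration_in_stratum:
  fixes B :: "'n::finite \<Rightarrow> int ^ 'd::finite" and u :: "nat \<Rightarrow> complex ^ 'd"
  assumes L: "arr_flat B L"
    and lev: "\<And>i. lev i \<le> m" "\<And>i. i \<in> vec_flat B L \<longleftrightarrow> lev i < j" "j \<le> m"
    and above: "\<And>i l. lev i < l \<Longrightarrow> l \<le> m \<Longrightarrow> pairing (B i) (u l) = 0"
    and at: "\<And>i. pairing (B i) (u (lev i)) \<noteq> 0"
    and \<theta>: "\<And>i. sgn (pairing (B i) (u (lev i))) = cis (\<theta> i)"
  shows "torus_exp (\<Sum>i\<in>UNIV. \<theta> i *\<^sub>R real_vec (B i)) \<in> phase_stratum B L"
proof -
  let ?F = "vec_flat B L"
  \<comment> \<open>lo i is the first exponent that the form of i sees: 0 on the quotient by L, j on L itself\<close>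
  define lo where "lo i = (if i \<in> ?F then 0 else j)" for i
  define y where "y k R = (\<Sum>l=k..m. of_real (R ^ l) *s u l)" for k and R :: real
  define z where "z R i = (\<Sum>l=lo i..m. of_real (R ^ l) * pairing (B i) (u l))" for i and R :: real
  have z: "z R i = pairing (B i) (y (lo i) R)" for R i
    by (simp add: z_def y_def pairing_sum_right pairing_scale_right)
  have lo: "lo i \<le> lev i" for i using lev(2) by (auto simp: lo_def)
  have lim: "((\<lambda>R. sgn (z R i)) \<longlongrightarrow> cis (\<theta> i)) at_top" for i
    using leading_term_sgn(1)[of "lo i" "lev i" m "\<lambda>l. pairing (B i) (u l)"] lo lev(1) at above \<theta>
    by (simp add: z_def)
  have "eventually (\<lambda>R. z R i \<noteq> 0) at_top" for i
    using leading_term_sgn(2)[of "lo i" "lev i" m "\<lambda>l. pairing (B i) (u l)"] lo lev(1) at above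
    by (simp add: z_def)
  then have nz: "eventually (\<lambda>R. \<forall>i. z R i \<noteq> 0) at_top"
    by (rule eventually_all_finite)
  have yL: "y j R \<in> L" for R
  proof (rule arr_flat_memI[OF L])
    fix i assume "i \<in> ?F"
    then show "pairing (B i) (y j R) = 0"
      using above[of i] lev(2)[of i]
      by (auto simp: y_def pairing_sum_right pairing_scale_right intro!: sum.neutral)
  qed
  have "eventually (\<lambda>R. arg_map (phi UNIV B (z R)) \<in> phase_stratum B L) at_top"
    using nz
  proof eventually_elim
    case (elim R)
    have nz': "pairing (B i) (y (lo i) R) \<noteq> 0" for i using elim z by simp
    have "pairing (B i) (y 0 R) \<noteq> 0" if "i \<in> ?F" for i
      using nz'[of i] that by (simp add: lo_def)
    then have "restrict (z R) ?F \<in> arr_compl ?F B UNIV"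
      unfolding arr_compl_def
      by (intro image_eqI[of _ _ "y 0 R"]) (auto simp: fun_eq_iff z lo_def)
    moreover have "pairing (B i) (y j R) \<noteq> 0" if "i \<notin> ?F" for i
      using nz'[of i] that by (simp add: lo_def)
    then have "restrict (z R) (- ?F) \<in> arr_compl (- ?F) B L"
      unfolding arr_compl_def
      by (intro image_eqI[of _ _ "y j R"]) (auto simp: fun_eq_iff z lo_def yL)
    ultimately have "z R \<in> initial_compl B L" by (simp add: initial_compl_def)
    then show ?case
      unfolding phase_stratum_def closed_coamoeba_def coamoeba_def
      by (intro subsetD[OF closure_subset]) auto
  qed
  moreover have "((\<lambda>R. arg_map (phi UNIV B (z R))) \<longlongrightarrow>
      torus_exp (\<Sum>i\<in>UNIV. \<theta> i *\<^sub>R real_vec (B i))) at_top"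
  proof -
    have "((\<lambda>R. phi UNIV B (\<lambda>i. sgn (z R i))) \<longlongrightarrow> phi UNIV B (\<lambda>i. cis (\<theta> i))) at_top"
      unfolding phi_def by (intro tendsto_intros lim) auto
    moreover have "phi UNIV B (\<lambda>i. cis (\<theta> i)) = torus_exp (\<Sum>i\<in>UNIV. \<theta> i *\<^sub>R real_vec (B i))"
      using arg_map_phi_torus_exp[of UNIV "\<lambda>i. cis (\<theta> i)" \<theta> B]
      unfolding arg_map_phi by (simp add: sgn_div_norm)
    ultimately show ?thesis by (simp add: arg_map_phi)
  qed
  ultimately show ?thesis
    by (rule Lim_in_closed_set[OF closed_phase_stratum _ trivial_limit_at_top_linorder])
qed

section \<open>Vectors adapted to a non-splitting flag\<close>

text \<open>Flats are defined by complex points, ranks by real spans; a complex point kills an integral vector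
iff its real and imaginary parts do, so a flat contains every vector of \<open>B\<close> in its real span.\<close>

lemma flat_closed_under_real_span:
  assumes "real_vec (B k) \<in> rspan B (vec_flat B L)"
  shows "k \<in> vec_flat B L"
proof -
  have "real_vec (B k) \<bullet> w = 0" if w: "\<And>i. i \<in> vec_flat B L \<Longrightarrow> real_vec (B i) \<bullet> w = 0" for w
    using assms by (rule span_induct)
      (auto simp: w subspace_def inner_add_left)
  then show ?thesis
    by (auto simp: vec_flat_def complex_eq_iff Re_pairing Im_pairing)
qed

text \<open>Take for \<open>v\<close> the component orthogonal to \<open>span F\<^sub>i\<close> of a vector of \<open>F\<^sub>i\<^sub>+\<^sub>1 - F\<^sub>i\<close>. As the rank
grows by one, \<open>v\<close> spans the orthogonal complement of \<open>span F\<^sub>i\<close> in \<open>span F\<^sub>i\<^sub>+\<^sub>1\<close>. The rank of the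
last step is not part of the definition of a flag; there it is bounded by the dimension \<open>d\<close>.\<close>

lemma flag_step_vector:
  fixes B :: "'n::finite \<Rightarrow> int ^ 'd::finite"
  assumes F: "nonsplitting_flag B F" and i: "i < CARD('d)"
  obtains v where "\<And>x. x \<in> rspan B (F i) \<Longrightarrow> x \<bullet> v = 0"
    and "\<And>k. k \<in> F (Suc i) \<Longrightarrow> k \<notin> F i \<Longrightarrow> real_vec (B k) \<bullet> v \<noteq> 0"
    and "\<And>x. x \<in> rspan B (F (Suc i)) \<Longrightarrow> x \<bullet> v = 0 \<Longrightarrow> x \<in> rspan B (F i)"
    and "dim (rspan B (F (Suc i))) = Suc i"
proof -
  have sub: "F i \<subset> F (Suc i)" and dimi: "dim (rspan B (F i)) = i"
    using F i by (auto simp: nonsplitting_flag_def)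
  obtain L where L: "F i = vec_flat B L"
    using F i by (auto simp: nonsplitting_flag_def)
  have new: "real_vec (B k) \<notin> rspan B (F i)" if "k \<notin> F i" for k
    using flat_closed_under_real_span[of B k L] that L by auto
  obtain k0 where k0: "k0 \<in> F (Suc i)" "k0 \<notin> F i" using sub by auto
  let ?b = "real_vec (B k0)"
  obtain y v where y: "y \<in> rspan B (F i)" and v: "\<And>w. w \<in> rspan B (F i) \<Longrightarrow> orthogonal v w"
    and b: "?b = y + v"
    using orthogonal_subspace_decomp_exists[of "(real_vec \<circ> B) ` F i" ?b] by metis
  have vk: "x \<bullet> v = 0" if "x \<in> rspan B (F i)" for x
    using v[OF that] by (simp add: orthogonal_def inner_commute)
  have v0: "v \<noteq> 0" using b y new[OF k0(2)] by auto
  let ?S = "span (insert ?b ((real_vec \<circ> B) ` F i))"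
  have dimS: "dim ?S = Suc i"
    using new[OF k0(2)] dimi by (simp add: dim_insert)
  have "?S \<subseteq> rspan B (F (Suc i))"
    using k0 sub by (intro span_mono) auto
  moreover have dim_le: "dim (rspan B (F (Suc i))) \<le> Suc i"
  proof (cases "Suc i < CARD('d)")
    case True
    then show ?thesis using F by (auto simp: nonsplitting_flag_def)
  next
    case False
    then show ?thesis using i dim_subset_UNIV[of "rspan B (F (Suc i))"] by simp
  qed
  ultimately have S: "?S = rspan B (F (Suc i))"
    using dimS by (intro subspace_dim_equal) auto
  have decomp: "\<exists>c. x - c *\<^sub>R ?b \<in> rspan B (F i) \<and> x \<bullet> v = c * (v \<bullet> v)"
    if "x \<in> rspan B (F (Suc i))" for x
  proof -
    have "\<exists>c. x - c *\<^sub>R ?b \<in> rspan B (F i)"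
      using that unfolding S[symmetric] span_breakdown_eq .
    then obtain c where c: "x - c *\<^sub>R ?b \<in> rspan B (F i)" by (elim exE)
    have "x \<bullet> v = c * (?b \<bullet> v)" using vk[OF c] by (simp add: inner_diff_left)
    also have "?b \<bullet> v = v \<bullet> v" using b vk[OF y] by (simp add: inner_add_left)
    finally show ?thesis using c by blast
  qed
  have split: "x \<in> rspan B (F i)" if "x \<in> rspan B (F (Suc i))" "x \<bullet> v = 0" for x
    using decomp[OF that(1)] that(2) v0 by auto
  show ?thesis
  proof (rule that[of v])
    show "real_vec (B k) \<bullet> v \<noteq> 0" if "k \<in> F (Suc i)" "k \<notin> F i" for k
      using split[of "real_vec (B k)"] new[OF that(2)] that(1) by (auto intro: span_base)
    show "dim (rspan B (F (Suc i))) = Suc i" using S dimS by simp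
  qed (use vk split in auto)
qed

text \<open>The properties of a non-splitting flag that the degeneration argument uses: \<open>v\<^sub>i\<close> is a linear
coordinate on \<open>span F\<^sub>i\<^sub>+\<^sub>1\<close> modulo \<open>span F\<^sub>i\<close>, nonzero on every new vector (\<open>v_detects\<close>) and, for
all steps but the last, on the sum of the flat (\<open>v_sum\<close>, the non-splitting condition).\<close>

locale adapted_flag =
  fixes B :: "'n::finite \<Rightarrow> int ^ 'd::finite" and F :: "nat \<Rightarrow> 'n set" and v :: "nat \<Rightarrow> real ^ 'd"
  assumes F_0: "F 0 = {}"
    and F_top: "F CARD('d) = UNIV"
    and F_step: "\<And>i. i < CARD('d) \<Longrightarrow> F i \<subseteq> F (Suc i)"
    and spanning: "rspan B UNIV = UNIV"
    and v_kills: "\<And>i k. i < CARD('d) \<Longrightarrow> k \<in> F i \<Longrightarrow> real_vec (B k) \<bullet> v i = 0"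
    and v_detects: "\<And>i k. i < CARD('d) \<Longrightarrow> k \<in> F (Suc i) \<Longrightarrow> k \<notin> F i \<Longrightarrow> real_vec (B k) \<bullet> v i \<noteq> 0"
    and v_separates: "\<And>i x. i < CARD('d) \<Longrightarrow> x \<in> rspan B (F (Suc i)) \<Longrightarrow> x \<bullet> v i = 0 \<Longrightarrow> x \<in> rspan B (F i)"
    and v_sum: "\<And>i. Suc i < CARD('d) \<Longrightarrow> (\<Sum>k\<in>F (Suc i). real_vec (B k)) \<bullet> v i \<noteq> 0"

lemma nonsplitting_flag_adapted:
  fixes B :: "'n::finite \<Rightarrow> int ^ 'd::finite"
  assumes F: "nonsplitting_flag B F"
  obtains v where "adapted_flag B F v"
proof -
  have "\<exists>v. (\<forall>x\<in>rspan B (F i). x \<bullet> v = 0) \<and>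
      (\<forall>k\<in>F (Suc i) - F i. real_vec (B k) \<bullet> v \<noteq> 0) \<and>
      (\<forall>x\<in>rspan B (F (Suc i)). x \<bullet> v = 0 \<longrightarrow> x \<in> rspan B (F i))"
    if "i < CARD('d)" for i
    by (rule flag_step_vector[OF F that]) blast
  then obtain v where v: "\<And>i. i < CARD('d) \<Longrightarrow> (\<forall>x\<in>rspan B (F i). x \<bullet> v i = 0) \<and>
      (\<forall>k\<in>F (Suc i) - F i. real_vec (B k) \<bullet> v i \<noteq> 0) \<and>
      (\<forall>x\<in>rspan B (F (Suc i)). x \<bullet> v i = 0 \<longrightarrow> x \<in> rspan B (F i))"
    by metis
  have F0: "F 0 = {}" and Ft: "F CARD('d) = UNIV" and Fs: "\<And>i. i < CARD('d) \<Longrightarrow> F i \<subseteq> F (Suc i)"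
    using F by (auto simp: nonsplitting_flag_def)
  show ?thesis
  proof (rule that[of v], unfold_locales)
    show "rspan B UNIV = UNIV"
      by (rule flag_step_vector[OF F, of "CARD('d) - 1"])
        (use Ft dim_eq_full[of "(real_vec \<circ> B) ` UNIV"] in \<open>auto simp: Suc_diff_1\<close>)
    show "(\<Sum>k\<in>F (Suc i). real_vec (B k)) \<bullet> v i \<noteq> 0" if "Suc i < CARD('d)" for i
    proof
      assume "(\<Sum>k\<in>F (Suc i). real_vec (B k)) \<bullet> v i = 0"
      moreover have "(\<Sum>k\<in>F (Suc i). real_vec (B k)) \<in> rspan B (F (Suc i))"
        by (intro span_sum span_base) auto
      ultimately have "real_vec (\<Sum>k\<in>F (Suc i). B k) \<in> rspan B (F i)"
        using v[of i] that by (simp add: real_vec_sum)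
      moreover have "real_vec (\<Sum>k\<in>F (Suc i). B k) \<notin> rspan B (F (Suc i - 1))"
        using F that unfolding nonsplitting_flag_def by (metis atLeastLessThan_iff le_add1 plus_1_eq_Suc)
      ultimately show False by simp
    qed
    show "real_vec (B k) \<bullet> v i = 0" if "i < CARD('d)" "k \<in> F i" for i k
      using v[OF that(1)] that(2) by (auto intro: span_base)
  qed (use v F0 Ft Fs in auto)
qed

context adapted_flag
begin

definition level :: "'n \<Rightarrow> nat" where
  "level k = (LEAST l. k \<in> F (Suc l))"

lemma F_mono: "i \<le> l \<Longrightarrow> l \<le> CARD('d) \<Longrightarrow> F i \<subseteq> F l"
proof (induction l rule: dec_induct)
  case (step n)
  then show ?case using F_step[of n] by (meson Suc_leD Suc_le_lessD subset_trans)
qed simp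

lemma mem_F_iff_level: "l \<le> CARD('d) \<Longrightarrow> k \<in> F l \<longleftrightarrow> level k < l"
proof
  assume l: "l \<le> CARD('d)"
  have "k \<in> F (Suc (CARD('d) - 1))" using F_top by (simp add: Suc_diff_1)
  then have mem: "k \<in> F (Suc (level k))" unfolding level_def by (rule LeastI)
  show "level k < l \<Longrightarrow> k \<in> F l" using F_mono[of "Suc (level k)" l] mem l by auto
  show "level k < l" if "k \<in> F l"
  proof (cases l)
    case 0
    then show ?thesis using that F_0 by simp
  next
    case (Suc i)
    then show ?thesis using that Least_le[of "\<lambda>l. k \<in> F (Suc l)" i] by (simp add: level_def)
  qed
qed

lemma level_less: "level k < CARD('d)"
  using mem_F_iff_level[of "CARD('d)" k] F_top by simp

text \<open>This is where non-splitting enters. A weight that depends only on the level turns the sum into a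
combination of the vectors \<open>\<beta>\<^sub>i = \<Sum>\<^bsub>b \<in> F\<^sub>i\<^sub>+\<^sub>1 - F\<^sub>i\<^esub> b\<close>, and \<open>\<beta>\<^sub>i\<close> is nonzero in the coordinate
\<open>v\<^sub>i\<close>, so these vectors span \<open>span F\<^sub>m\<close> by induction on \<open>m\<close>.\<close>

lemma span_by_level_weights:
  assumes "m < CARD('d)" "x \<in> rspan B (F m)"
  shows "\<exists>s. x = (\<Sum>k\<in>F m. s (level k) *\<^sub>R real_vec (B k))"
  using assms
proof (induction m arbitrary: x)
  case 0
  then show ?case using F_0 by simp
next
  case (Suc m)
  define \<beta> where "\<beta> = (\<Sum>k\<in>F (Suc m) - F m. real_vec (B k))"
  have sub: "F m \<subseteq> F (Suc m)" using Suc.prems F_step by simp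
  have "(\<Sum>k\<in>F (Suc m). real_vec (B k)) = \<beta> + (\<Sum>k\<in>F m. real_vec (B k))"
    unfolding \<beta>_def using sub by (simp add: sum.subset_diff)
  moreover have "(\<Sum>k\<in>F m. real_vec (B k)) \<bullet> v m = 0"
    using v_kills Suc.prems by (simp add: inner_sum_left)
  ultimately have \<beta>v: "\<beta> \<bullet> v m \<noteq> 0"
    using v_sum[OF Suc.prems(1)] by (simp add: inner_add_left)
  have \<beta>: "\<beta> \<in> rspan B (F (Suc m))"
    unfolding \<beta>_def by (intro span_sum span_base) auto
  define c where "c = (x \<bullet> v m) / (\<beta> \<bullet> v m)"
  have "x - c *\<^sub>R \<beta> \<in> rspan B (F m)"
  proof (rule v_separates)
    show "x - c *\<^sub>R \<beta> \<in> rspan B (F (Suc m))"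
      using Suc.prems \<beta> by (intro span_diff span_scale) auto
    show "(x - c *\<^sub>R \<beta>) \<bullet> v m = 0" using \<beta>v by (simp add: inner_diff_left c_def)
  qed (use Suc.prems in simp)
  then obtain s where s: "x - c *\<^sub>R \<beta> = (\<Sum>k\<in>F m. s (level k) *\<^sub>R real_vec (B k))"
    using Suc by auto
  let ?s = "s(m := c)"
  have lev: "level k = m" if "k \<in> F (Suc m) - F m" for k
    using that mem_F_iff_level[of m k] mem_F_iff_level[of "Suc m" k] Suc.prems by auto
  have "(\<Sum>k\<in>F (Suc m). ?s (level k) *\<^sub>R real_vec (B k)) =
      (\<Sum>k\<in>F (Suc m) - F m. ?s (level k) *\<^sub>R real_vec (B k)) +
      (\<Sum>k\<in>F m. ?s (level k) *\<^sub>R real_vec (B k))"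
    using sub by (simp add: sum.subset_diff)
  also have "(\<Sum>k\<in>F (Suc m) - F m. ?s (level k) *\<^sub>R real_vec (B k)) = c *\<^sub>R \<beta>"
    unfolding \<beta>_def scaleR_sum_right by (intro sum.cong) (use lev in auto)
  also have "(\<Sum>k\<in>F m. ?s (level k) *\<^sub>R real_vec (B k)) = (\<Sum>k\<in>F m. s (level k) *\<^sub>R real_vec (B k))"
    using mem_F_iff_level[of m] Suc.prems by (intro sum.cong) auto
  finally show ?case using s by (intro exI[of _ ?s]) (simp add: algebra_simps)
qed

text \<open>The rotations \<open>cis (s l)\<close> of the vectors \<open>v\<^sub>l\<close> are free, and by \<open>span_by_level_weights\<close> they
shift the limit phase by an arbitrary element of \<open>span F\<^sub>m\<close>. The phases of the forms in
\<open>F\<^sub>m\<close> contribute an element of the same space and can be absorbed.\<close>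

lemma prism_in_stratum:
  assumes L: "arr_flat B L" "vec_flat B L = F j" and jm: "j \<le> m" and m: "m < CARD('d)"
    and y0: "\<And>k. k \<in> F m \<Longrightarrow> pairing (B k) y = 0"
    and y1: "\<And>k. k \<notin> F m \<Longrightarrow> pairing (B k) y \<noteq> 0"
    and \<theta>: "\<And>k. k \<notin> F m \<Longrightarrow> sgn (pairing (B k) y) = cis (\<theta> k)"
    and x: "x \<in> rspan B (F m)"
  shows "torus_exp (x + (\<Sum>k\<in>- F m. \<theta> k *\<^sub>R real_vec (B k))) \<in> phase_stratum B L"
proof -
  \<comment> \<open>the phases (0 or pi) that the real vectors v contribute to the forms in F m\<close>
  define \<epsilon> where "\<epsilon> k = Arg (pairing (B k) (complexify (v (level k))))" for k
  have "x - (\<Sum>k\<in>F m. \<epsilon> k *\<^sub>R real_vec (B k)) \<in> rspan B (F m)"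
    by (intro span_diff x span_sum span_scale span_base) auto
  then obtain s where s: "x - (\<Sum>k\<in>F m. \<epsilon> k *\<^sub>R real_vec (B k)) =
      (\<Sum>k\<in>F m. s (level k) *\<^sub>R real_vec (B k))"
    using span_by_level_weights[OF m] by blast
  define u where "u l = (if l < m then cis (s l) *s complexify (v l) else y)" for l
  define lev where "lev k = min (level k) m" for k
  define \<phi> where "\<phi> k = (if k \<in> F m then s (level k) + \<epsilon> k else \<theta> k)" for k
  have mem: "k \<in> F m \<longleftrightarrow> level k < m" for k using mem_F_iff_level m by simp
  have v_level: "pairing (B k) (complexify (v (level k))) \<noteq> 0" for k
    using v_detects[OF level_less, of k k] mem_F_iff_level[of "Suc (level k)" k]
      mem_F_iff_level[of "level k" k] level_less[of k]
    by (simp add: pairing_complexify)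
  have u_at: "pairing (B k) (u (lev k)) =
      (if k \<in> F m then cis (s (level k)) * pairing (B k) (complexify (v (level k)))
       else pairing (B k) y)" for k
    using mem[of k] by (auto simp: u_def lev_def pairing_scale_right min_def)
  have "torus_exp (\<Sum>k\<in>UNIV. \<phi> k *\<^sub>R real_vec (B k)) \<in> phase_stratum B L"
  proof (rule degeneration_in_stratum[of B L lev m j u])
    show "k \<in> vec_flat B L \<longleftrightarrow> lev k < j" for k
      using L(2) mem_F_iff_level[of j k] jm m by (auto simp: lev_def)
    show "pairing (B k) (u l) = 0" if "lev k < l" "l \<le> m" for k l
    proof (cases "l < m")
      case True
      then show ?thesis
        using that m v_kills[of l k] mem_F_iff_level[of l k]
        by (auto simp: u_def lev_def pairing_scale_right pairing_complexify min_def split: if_splits)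
    next
      case False
      then show ?thesis using that y0[of k] mem[of k] by (auto simp: u_def lev_def)
    qed
    show "pairing (B k) (u (lev k)) \<noteq> 0" for k
      using y1[of k] v_level[of k] by (auto simp: u_at)
    show "sgn (pairing (B k) (u (lev k))) = cis (\<phi> k)" for k
      using \<theta>[of k] v_level[of k]
      by (auto simp: u_at \<phi>_def sgn_mult cis_Arg \<epsilon>_def simp flip: cis_mult)
  qed (use L jm in \<open>auto simp: lev_def\<close>)
  moreover have "(\<Sum>k\<in>UNIV. \<phi> k *\<^sub>R real_vec (B k)) = x + (\<Sum>k\<in>- F m. \<theta> k *\<^sub>R real_vec (B k))"
  proof -
    have "(\<Sum>k\<in>UNIV. \<phi> k *\<^sub>R real_vec (B k)) =
        (\<Sum>k\<in>F m. \<phi> k *\<^sub>R real_vec (B k)) + (\<Sum>k\<in>- F m. \<phi> k *\<^sub>R real_vec (B k))"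
      by (subst sum.union_disjoint[symmetric]) (auto simp: Un_commute)
    also have "(\<Sum>k\<in>- F m. \<phi> k *\<^sub>R real_vec (B k)) = (\<Sum>k\<in>- F m. \<theta> k *\<^sub>R real_vec (B k))"
      by (intro sum.cong) (auto simp: \<phi>_def)
    also have "(\<Sum>k\<in>F m. \<phi> k *\<^sub>R real_vec (B k)) =
        (\<Sum>k\<in>F m. s (level k) *\<^sub>R real_vec (B k)) + (\<Sum>k\<in>F m. \<epsilon> k *\<^sub>R real_vec (B k))"
      by (simp add: \<phi>_def scaleR_add_left sum.distrib)
    finally show ?thesis using s by (simp add: algebra_simps)
  qed
  ultimately show ?thesis by simp
qed

end

section \<open>The quotient by the lattice of a flat\<close>

text \<open>For additive \<open>q\<close> this is the real-linear extension of \<open>q\<close>, i.e. \<open>torus_map q\<close> on the universal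
cover.\<close>

definition real_ext :: "(int ^ 'd::finite \<Rightarrow> int ^ 'k::finite) \<Rightarrow> real ^ 'd \<Rightarrow> real ^ 'k" where
  "real_ext q x = (\<Sum>j\<in>UNIV. x $ j *\<^sub>R real_vec (q (axis j 1)))"

lemma linear_real_ext: "linear (real_ext q)"
  by (intro linearI) (auto simp: real_ext_def scaleR_add_left sum.distrib scaleR_sum_right)

lemma torus_map_torus_exp: "torus_map q (torus_exp x) = torus_exp (real_ext q x)"
  by (simp add: vec_eq_iff torus_map_def real_ext_def cis_power_int cis_sum mult.commute)

lemma additive_zero:
  fixes q :: "'a::ab_group_add \<Rightarrow> 'b::ab_group_add"
  assumes "\<And>x y. q (x + y) = q x + q y"
  shows "q 0 = 0"
  using assms[of 0 0] by simp

lemma additive_scale: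
  fixes q :: "int ^ 'd \<Rightarrow> int ^ 'k"
  assumes add: "\<And>x y. q (x + y) = q x + q y"
  shows "q (c *s x) = c *s q x"
proof -
  have 0: "q 0 = 0" by (rule additive_zero[of q, OF add])
  have minus: "q (- x) = - q x" for x
    using add[of x "- x"] 0 by (simp add: eq_neg_iff_add_eq_0 add.commute)
  have nat: "q (int n *s x) = int n *s q x" for n
  proof (induction n)
    case (Suc n)
    have Suc_scale: "int (Suc n) *s y = y + int n *s y" for y :: "int ^ 'e"
      by (simp add: vec_eq_iff distrib_right)
    show ?case by (simp only: Suc_scale add Suc.IH)
  qed (simp add: 0)
  have neg: "(- c) *s y = - (c *s y)" for c :: int and y :: "int ^ 'e" by (simp add: vec_eq_iff)
  show ?thesis
    by (cases c rule: int_cases2) (simp_all add: nat neg minus)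
qed

lemma additive_sum:
  fixes q :: "'a::ab_group_add \<Rightarrow> 'b::ab_group_add"
  assumes add: "\<And>x y. q (x + y) = q x + q y"
  shows "q (\<Sum>i\<in>I. f i) = (\<Sum>i\<in>I. q (f i))"
  by (induction I rule: infinite_finite_induct) (auto simp: add additive_zero[of q, OF add])

lemma int_vec_expansion: "(x :: int ^ 'd::finite) = (\<Sum>j\<in>UNIV. x $ j *s axis j 1)"
  by (simp add: vec_eq_iff axis_def if_distrib cong: if_cong)

lemma additive_expansion:
  fixes q :: "int ^ 'd::finite \<Rightarrow> int ^ 'k"
  assumes add: "\<And>x y. q (x + y) = q x + q y"
  shows "q x = (\<Sum>j\<in>UNIV. x $ j *s q (axis j 1))"
  by (subst int_vec_expansion[of x]) (simp add: additive_sum[of q, OF add] additive_scale[of q, OF add])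

lemma real_ext_real_vec:
  assumes "\<And>x y. q (x + y) = q x + q y"
  shows "real_ext q (real_vec b) = real_vec (q b)"
  by (subst additive_expansion[of q, OF assms])
    (simp add: real_ext_def real_vec_sum real_vec_scale)

lemma flat_perp_pairing:
  assumes "x \<in> flat_perp B L" "y \<in> L"
  shows "pairing x y = (0 :: complex)"
proof -
  obtain k c where k: "k \<noteq> 0" "k *s x = (\<Sum>i\<in>vec_flat B L. c i *s B i)"
    using assms(1) by (auto simp: flat_perp_def saturation_def zspan_def)
  have "of_int k * pairing x y = pairing (k *s x) y" by (simp add: pairing_scale_left)
  also have "\<dots> = (\<Sum>i\<in>vec_flat B L. of_int (c i) * pairing (B i) y)"
    by (simp add: k pairing_sum_left pairing_scale_left)
  also have "\<dots> = 0" using assms(2) by (intro sum.neutral) (auto simp: vec_flat_def)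
  finally show ?thesis using k by simp
qed

lemma flat_perp_real_span:
  assumes "x \<in> flat_perp B L"
  shows "real_vec x \<in> rspan B (vec_flat B L)"
proof -
  obtain k c where k: "k \<noteq> 0" "k *s x = (\<Sum>i\<in>vec_flat B L. c i *s B i)"
    using assms(1) by (auto simp: flat_perp_def saturation_def zspan_def)
  have "of_int k *\<^sub>R real_vec x = (\<Sum>i\<in>vec_flat B L. of_int (c i) *\<^sub>R real_vec (B i))"
    using arg_cong[OF k(2), of real_vec] by (simp add: real_vec_scale real_vec_sum)
  also have "\<dots> \<in> rspan B (vec_flat B L)"
    by (intro span_sum span_scale span_base) auto
  finally have "inverse (of_int k) *\<^sub>R (of_int k *\<^sub>R real_vec x) \<in> rspan B (vec_flat B L)"
    by (rule span_scale)
  then show ?thesis using k(1) by simp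
qed

lemma mem_flat_perp: 
  assumes "i \<in> vec_flat B L"
  shows "B i \<in> flat_perp B L"
proof -
  have "1 *s B i = (\<Sum>k\<in>vec_flat B L. (if k = i then 1 else 0) *s B k)"
    using assms by (simp add: if_distrib[of "\<lambda>c. c *s _"] cong: if_cong)
  then show ?thesis
    unfolding flat_perp_def saturation_def zspan_def
    by (intro CollectI exI[of _ 1]) (auto intro: exI)
qed

locale flat_quotient =
  fixes B :: "'n::finite \<Rightarrow> int ^ 'd::finite" and L :: "(complex ^ 'd) set"
    and q :: "int ^ 'd \<Rightarrow> int ^ 'k::finite"
  assumes L: "arr_flat B L" and q: "lattice_quotient q (flat_perp B L)"
begin

lemma q_add: "q (x + y) = q x + q y"
  and q_surj: "surj q"
  and q_eq_0_iff: "q x = 0 \<longleftrightarrow> x \<in> flat_perp B L"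
  using q by (auto simp: lattice_quotient_def)

definition lift :: "'k \<Rightarrow> int ^ 'd" where
  "lift l = inv q (axis l 1)"

text \<open>The vectors \<open>lift l\<close> define a section of \<open>q\<close>, so this is the integral projection onto the kernel
of \<open>q\<close> along the section.\<close>

definition correction :: "int ^ 'd \<Rightarrow> int ^ 'd" where
  "correction x = x - (\<Sum>l\<in>UNIV. q x $ l *s lift l)"

lemma correction_in_flat_perp: "correction x \<in> flat_perp B L"
proof -
  have q_lift: "q (lift l) = axis l 1" for l
    unfolding lift_def by (rule surj_f_inv_f[OF q_surj])
  have "q (\<Sum>l\<in>UNIV. q x $ l *s lift l) = q x"
    by (simp add: additive_sum[of q, OF q_add] additive_scale[of q, OF q_add] q_lift
      flip: int_vec_expansion)
  moreover have "q x = q (correction x) + q (\<Sum>l\<in>UNIV. q x $ l *s lift l)"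
    unfolding q_add[symmetric] by (simp add: correction_def)
  ultimately show ?thesis by (simp add: q_eq_0_iff[symmetric])
qed

text \<open>The transpose of \<open>q\<close> identifies \<open>C\<^sup>k\<close> with \<open>L\<close>, with inverse the transpose of the section, and it
turns the forms of \<open>q b\<close> into the restrictions to \<open>L\<close> of the forms of \<open>b\<close>.\<close>

lemma restricted_arrangement:
  "arr_compl (- vec_flat B L) (\<lambda>i. q (B i)) UNIV = arr_compl (- vec_flat B L) B L"
proof -
  have pull: "pairing b (\<chi> j. pairing (q (axis j 1)) w) = pairing (q b) w" for b and w :: "complex ^ 'k"
    by (subst additive_expansion[of q, OF q_add])
      (simp add: pairing_sum_left pairing_scale_left, simp add: pairing_def)
  have push: "pairing (q b) (\<chi> l. pairing (lift l) y) = pairing b y" if "y \<in> L" for b y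
  proof -
    have "pairing b y = pairing (correction b) y + pairing (\<Sum>l\<in>UNIV. q b $ l *s lift l) y"
      unfolding pairing_add_left[symmetric] by (simp add: correction_def)
    also have "pairing (correction b) y = 0"
      by (rule flat_perp_pairing[OF correction_in_flat_perp that])
    also have "0 + pairing (\<Sum>l\<in>UNIV. q b $ l *s lift l) y = pairing (q b) (\<chi> l. pairing (lift l) y)"
      by (simp add: pairing_sum_left pairing_scale_left, simp add: pairing_def)
    finally show ?thesis by simp
  qed
  show ?thesis
  proof (intro equalityI subsetI)
    fix z assume "z \<in> arr_compl (- vec_flat B L) (\<lambda>i. q (B i)) UNIV"
    then obtain w where w: "z = (\<lambda>i\<in>- vec_flat B L. pairing (q (B i)) w)"
      "\<forall>i\<in>- vec_flat B L. pairing (q (B i)) w \<noteq> 0"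
      by (auto simp: arr_compl_def)
    let ?y = "\<chi> j. pairing (q (axis j 1)) w"
    have "?y \<in> L"
    proof (rule arr_flat_memI[OF L])
      fix i assume "i \<in> vec_flat B L"
      then have "q (B i) = 0" using q_eq_0_iff mem_flat_perp by blast
      then show "pairing (B i) ?y = 0" by (simp add: pull)
    qed
    then show "z \<in> arr_compl (- vec_flat B L) B L"
      unfolding arr_compl_def by (intro image_eqI[of _ _ ?y]) (use w in \<open>auto simp: pull\<close>)
  next
    fix z assume "z \<in> arr_compl (- vec_flat B L) B L"
    then obtain y where y: "z = (\<lambda>i\<in>- vec_flat B L. pairing (B i) y)"
      "\<forall>i\<in>- vec_flat B L. pairing (B i) y \<noteq> 0" "y \<in> L"
      by (auto simp: arr_compl_def)
    show "z \<in> arr_compl (- vec_flat B L) (\<lambda>i. q (B i)) UNIV"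
      unfolding arr_compl_def
      by (intro image_eqI[of _ _ "\<chi> l. pairing (lift l) y"]) (use y in \<open>auto simp: push\<close>)
  qed
qed

text \<open>Extending the splitting of \<open>q\<close> to real vectors shows that the kernel of the real extension is
spanned by the integral kernel, which is the saturated lattice of the flat.\<close>

lemma real_ext_kernel:
  assumes "real_ext q x = 0"
  shows "x \<in> rspan B (vec_flat B L)"
proof -
  let ?s = "\<lambda>w :: real ^ 'k. \<Sum>l\<in>UNIV. w $ l *\<^sub>R real_vec (lift l)"
  have s: "linear ?s" by (intro linearI) (auto simp: scaleR_add_left sum.distrib scaleR_sum_right)
  have corr: "real_vec (correction b) = real_vec b - ?s (real_vec (q b))" for b
    by (simp add: correction_def vec_eq_iff)
  have "(\<Sum>j\<in>UNIV. x $ j *\<^sub>R real_vec (correction (axis j 1))) =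
      (\<Sum>j\<in>UNIV. x $ j *\<^sub>R real_vec (axis j 1)) - ?s (real_ext q x)"
    unfolding corr real_ext_def linear_sum[OF s] linear_scale[OF s]
    by (simp add: scaleR_diff_right sum_subtractf)
  also have "(\<Sum>j\<in>UNIV. x $ j *\<^sub>R real_vec (axis j 1)) = x"
    by (simp add: vec_eq_iff axis_def if_distrib cong: if_cong)
  also have "?s (real_ext q x) = 0" using assms by simp
  finally have "x = (\<Sum>j\<in>UNIV. x $ j *\<^sub>R real_vec (correction (axis j 1)))" by simp
  also have "\<dots> \<in> rspan B (vec_flat B L)"
    by (intro span_sum span_scale flat_perp_real_span correction_in_flat_perp)
  finally show ?thesis .
qed

text \<open>Two exponents with the same image in the torus differ, after applying \<open>q\<close>, by \<open>2 pi\<close> times an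
integral vector. This vector lifts through the surjection \<open>q\<close>, so a change of one exponent by a
period brings the difference into the real kernel. In particular the kernel torus is connected.\<close>

lemma torus_map_fibre:
  assumes "torus_map q (torus_exp x) = torus_map q (torus_exp y)"
  obtains w where "w \<in> rspan B (vec_flat B L)" "torus_exp x = torus_exp (w + y)"
proof -
  obtain n where n: "real_ext q x = real_ext q y + (2 * pi) *\<^sub>R real_vec n"
    using assms unfolding torus_map_torus_exp torus_exp_eq_iff by blast
  obtain m where m: "n = q m" using q_surj by (metis surjD)
  let ?w = "x - y - (2 * pi) *\<^sub>R real_vec m"
  have "real_ext q ?w = 0"
    unfolding linear_diff[OF linear_real_ext] linear_scale[OF linear_real_ext]
    by (simp add: n m real_ext_real_vec[OF q_add])
  then have "?w \<in> rspan B (vec_flat B L)" by (rule real_ext_kernel)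
  moreover have "torus_exp x = torus_exp (?w + y)"
    unfolding torus_exp_eq_iff by (intro exI[of _ m]) simp
  ultimately show ?thesis by (rule that)
qed

end

section \<open>Compactness and closures in the torus\<close>

lemma continuous_on_torus_map: "continuous_on ctorus (torus_map q)"
  unfolding torus_map_def ctorus_def by (intro continuous_intros) auto

lemma utorus_subset_ctorus: "utorus \<subseteq> ctorus"
proof
  fix t :: "complex ^ 'a" assume "t \<in> utorus"
  then have "cmod (t $ j) = 1" for j by (simp add: utorus_def)
  then have "t $ j \<noteq> 0" for j by (metis norm_zero zero_neq_one)
  then show "t \<in> ctorus" by (simp add: ctorus_def)
qed

lemma compact_utorus: "compact (utorus :: (complex ^ 'd::finite) set)"
proof -
  have eq: "utorus = (\<Inter>j. {t :: complex ^ 'd. cmod (t $ j) = 1})" by (auto simp: utorus_def)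
  have "closed (utorus :: (complex ^ 'd) set)"
    unfolding eq by (intro closed_INT ballI closed_Collect_eq continuous_intros)
  moreover have "bounded (utorus :: (complex ^ 'd) set)"
  proof (rule boundedI)
    fix t :: "complex ^ 'd" assume "t \<in> utorus"
    then have "(\<Sum>j\<in>UNIV. norm (t $ j)) = CARD('d)" by (simp add: utorus_def)
    then show "norm t \<le> CARD('d)" 
      using L2_set_le_sum[of UNIV "\<lambda>j. norm (t $ j)"] by (simp add: norm_vec_def)
  qed
  ultimately show ?thesis by (simp add: compact_eq_bounded_closed)
qed

lemma continuous_on_arg_map: "continuous_on ctorus arg_map"
  unfolding arg_map_def ctorus_def by (intro continuous_intros) auto

text \<open>By continuity of the argument map on the complex torus; points of the closure of \<open>X\<close> outside the
torus have to be excluded, since the argument map jumps there.\<close>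

lemma closed_coamoeba_torus_closure:
  assumes "X \<subseteq> ctorus"
  shows "closed_coamoeba (closure X \<inter> ctorus) = closed_coamoeba X"
proof -
  let ?C = "closure (arg_map ` X)"
  have "closedin (top_of_set ctorus) (ctorus \<inter> arg_map -` ?C)"
    by (rule continuous_closedin_preimage[OF continuous_on_arg_map closed_closure])
  then obtain T where T: "closed T" "ctorus \<inter> arg_map -` ?C = T \<inter> ctorus"
    by (auto simp: closedin_closed Int_commute)
  have "X \<subseteq> T" using T assms closure_subset[of "arg_map ` X"] by blast
  then have "closure X \<subseteq> T" by (rule closure_minimal[OF _ T(1)])
  then have "arg_map ` (closure X \<inter> ctorus) \<subseteq> ?C" using T(2) by blast
  then have "closed_coamoeba (closure X \<inter> ctorus) \<subseteq> closed_coamoeba X"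
    unfolding closed_coamoeba_def coamoeba_def by (rule closure_minimal) simp
  moreover have "closed_coamoeba X \<subseteq> closed_coamoeba (closure X \<inter> ctorus)"
    unfolding closed_coamoeba_def coamoeba_def
    using assms closure_subset[of X] by (intro closure_mono image_mono) auto
  ultimately show ?thesis by blast
qed

section \<open>The phases of a parametrized plane curve\<close>

text \<open>The affine function maps the upper half plane into an open half plane bounded by the real axis, where
\<open>Arg\<close> is the imaginary part of a holomorphic logarithm, or it is constant. The case \<open>c = 0\<close> is
included, so that no distinction between the forms is necessary later.\<close>

lemma has_derivative_Arg_affine:
  fixes a c :: real
  assumes "Im z > 0"
  shows "((\<lambda>z. Arg (of_real a + of_real c * z)) has_derivative
      (\<lambda>w. Im (of_real c / (of_real a + of_real c * z) * w))) (at z)"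
proof (cases "c = 0")
  case True
  then show ?thesis by simp
next
  case False
  let ?l = "\<lambda>z. of_real a + of_real c * z :: complex"
  have Im: "Im (?l z) = c * Im z" for z by simp
  have "?l z \<notin> \<real>\<^sub>\<le>\<^sub>0"
    using assms False Im[of z] by (simp add: complex_nonpos_Reals_iff)
  moreover have "(?l has_field_derivative of_real c) (at z)"
    by (auto intro!: derivative_eq_intros)
  ultimately have "((\<lambda>z. Ln (?l z)) has_field_derivative of_real c / ?l z) (at z)"
    using DERIV_chain2[OF has_field_derivative_Ln] by (simp add: divide_inverse mult.commute)
  then have Ln: "((\<lambda>z. Im (Ln (?l z))) has_derivative (\<lambda>w. Im (of_real c / ?l z * w))) (at z)"
    unfolding has_field_derivative_def
    by (rule bounded_linear.has_derivative[OF bounded_linear_Im])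
  have Arg: "Im (Ln (?l z)) = Arg (?l z)" if "z \<in> {z. Im z > 0}" for z
  proof -
    have "?l z \<noteq> 0"
      using Im[of z] False that by (metis less_irrefl mem_Collect_eq mult_eq_0_iff zero_complex.sel(2))
    then show ?thesis by (simp add: Arg_eq_Im_Ln)
  qed
  show ?thesis
    by (rule has_derivative_transform_within_open[OF Ln open_halfspace_Im_gt[of 0]])
      (use assms Arg in auto)
qed

text \<open>Multiply the sum by \<open>z\<close> and let \<open>z \<rightarrow> i \<infinity>\<close>: each term with \<open>\<gamma>\<^sub>i \<noteq> 0\<close> tends to \<open>\<alpha>\<^sub>i\<close>, each other term
is zero, and the sum of these limits is nonzero by hypothesis.\<close>

lemma exists_nonzero_log_derivative:
  fixes \<alpha> \<gamma> :: "'n::finite \<Rightarrow> real"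
  assumes ns: "(\<Sum>i | \<gamma> i = 0. \<alpha> i) \<noteq> (\<Sum>i\<in>UNIV. \<alpha> i)"
  obtains z where "Im z > 0"
    "(\<Sum>i\<in>UNIV. of_real (\<alpha> i) * (of_real (\<gamma> i) / (of_real (\<alpha> i) + of_real (\<gamma> i) * z))) \<noteq> (0::complex)"
proof -
  let ?z = "\<lambda>n::nat. \<i> * of_nat (Suc n)"
  let ?q = "\<lambda>i n. of_real (\<gamma> i) * ?z n / (of_real (\<alpha> i) + of_real (\<gamma> i) * ?z n)"
  have lim: "?q i \<longlonglongrightarrow> (if \<gamma> i = 0 then 0 else 1)" for i
  proof (cases "\<gamma> i = 0")
    case False
    have z: "filterlim ?z at_infinity sequentially"
      by (intro tendsto_mult_filterlim_at_infinity[OF tendsto_const] filterlim_compose[OF tendsto_of_nat filterlim_Suc]) auto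
    have "(\<lambda>n. of_real (\<alpha> i) / (of_real (\<gamma> i) * ?z n) + 1) \<longlonglongrightarrow> 0 + 1"
      by (intro tendsto_intros tendsto_divide_0[OF tendsto_const]
        tendsto_mult_filterlim_at_infinity[OF tendsto_const _ z]) (use False in auto)
    then have "(\<lambda>n. inverse (of_real (\<alpha> i) / (of_real (\<gamma> i) * ?z n) + 1)) \<longlonglongrightarrow> inverse (0 + 1)"
      by (rule tendsto_inverse) simp
    moreover have "inverse (of_real (\<alpha> i) / (of_real (\<gamma> i) * ?z n) + 1) = ?q i n" for n
      using False by (simp add: divide_simps del: of_nat_Suc)
    ultimately show ?thesis using False by simp
  qed simp
  have "(\<lambda>n. \<Sum>i\<in>UNIV. of_real (\<alpha> i) * ?q i n) \<longlonglongrightarrow>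
      (\<Sum>i\<in>UNIV. of_real (\<alpha> i) * (if \<gamma> i = 0 then 0 else 1))"
    by (intro tendsto_intros lim)
  moreover have "(\<Sum>i\<in>UNIV. of_real (\<alpha> i) * (if \<gamma> i = 0 then 0 else 1)) \<noteq> (0::complex)"
  proof -
    have "(\<Sum>i\<in>UNIV. of_real (\<alpha> i) * (if \<gamma> i = 0 then 0 else 1)) =
        (\<Sum>i\<in>UNIV. of_real (if \<gamma> i = 0 then 0 else \<alpha> i) :: complex)"
      by (intro sum.cong) auto
    also have "\<dots> = of_real (\<Sum>i | \<gamma> i \<noteq> 0. \<alpha> i)"
      by (simp add: sum.If_cases Collect_neg_eq flip: of_real_sum)
    also have "(\<Sum>i | \<gamma> i \<noteq> 0. \<alpha> i) = (\<Sum>i\<in>UNIV. \<alpha> i) - (\<Sum>i | \<gamma> i = 0. \<alpha> i)"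
      using sum.subset_diff[of "{i. \<gamma> i = 0}" UNIV \<alpha>]
      by (simp add: Compl_eq_Diff_UNIV[symmetric] Collect_neg_eq)
    finally show ?thesis using ns by (simp del: of_real_diff of_real_sum)
  qed
  ultimately have "eventually (\<lambda>n. (\<Sum>i\<in>UNIV. of_real (\<alpha> i) * ?q i n) \<noteq> 0) sequentially"
    by (rule tendsto_imp_eventually_ne)
  then obtain n where n: "(\<Sum>i\<in>UNIV. of_real (\<alpha> i) * ?q i n) \<noteq> 0"
    by (auto simp: eventually_sequentially)
  have "(\<Sum>i\<in>UNIV. of_real (\<alpha> i) * ?q i n) =
      ?z n * (\<Sum>i\<in>UNIV. of_real (\<alpha> i) * (of_real (\<gamma> i) / (of_real (\<alpha> i) + of_real (\<gamma> i) * ?z n)))"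
    unfolding sum_distrib_left by (intro sum.cong) (auto simp: divide_inverse mult_ac)
  then show ?thesis using that[of "?z n"] n by (auto simp del: of_nat_Suc)
qed

text \<open>\<open>f\<close> is the argument of the rational curve \<open>z \<mapsto> \<Prod> (\<alpha>\<^sub>i + \<gamma>\<^sub>i z)\<^bsup>(\<alpha>\<^sub>i, \<gamma>\<^sub>i)\<^esup>\<close>. Its logarithmic derivatives
satisfy \<open>g\<^sub>\<alpha> + z g\<^sub>\<gamma> = \<Sum> \<gamma>\<^sub>i = 0\<close>, so the derivative of \<open>f\<close> is \<open>w \<mapsto> (Im (- z u), Im u)\<close> with
\<open>u = g\<^sub>\<gamma> w\<close>. This is invertible wherever \<open>Im z > 0\<close> and \<open>g\<^sub>\<gamma> \<noteq> 0\<close>, and then \<open>f\<close> is open at \<open>z\<close>.\<close>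

lemma line_phases_have_interior:
  fixes \<alpha> \<gamma> :: "'n::finite \<Rightarrow> real"
  assumes sum0: "(\<Sum>i\<in>UNIV. \<gamma> i) = 0" and ns: "(\<Sum>i | \<gamma> i = 0. \<alpha> i) \<noteq> (\<Sum>i\<in>UNIV. \<alpha> i)"
  defines "\<theta> \<equiv> \<lambda>z i. Arg (of_real (\<alpha> i) + of_real (\<gamma> i) * z)"
  defines "f \<equiv> \<lambda>z. Complex (\<Sum>i\<in>UNIV. \<alpha> i * \<theta> z i) (\<Sum>i\<in>UNIV. \<gamma> i * \<theta> z i)"
  obtains z where "Im z > 0" "f z \<in> interior (f ` {z. Im z > 0})"
proof -
  define g where "g a z = (\<Sum>i\<in>UNIV. of_real (a i) * (of_real (\<gamma> i) / (of_real (\<alpha> i) + of_real (\<gamma> i) * z)))"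
    for a :: "'n \<Rightarrow> real" and z :: complex
  have scale: "a * Im w = Im (of_real a * w)" for a w by simp
  have f: "f = (\<lambda>z. of_real (\<Sum>i\<in>UNIV. \<alpha> i * \<theta> z i) + \<i> * of_real (\<Sum>i\<in>UNIV. \<gamma> i * \<theta> z i))"
    by (simp add: f_def complex_eq_iff fun_eq_iff)
  have der: "(f has_derivative (\<lambda>w. Complex (Im (g \<alpha> z * w)) (Im (g \<gamma> z * w)))) (at z)"
    if "Im z > 0" for z
  proof -
    have "((\<lambda>z. \<Sum>i\<in>UNIV. a i * \<theta> z i) has_derivative (\<lambda>w. Im (g a z * w))) (at z)"
      for a :: "'n \<Rightarrow> real"
    proof -
      have "((\<lambda>z. \<Sum>i\<in>UNIV. a i * \<theta> z i) has_derivative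
          (\<lambda>w. \<Sum>i\<in>UNIV. a i * Im (of_real (\<gamma> i) / (of_real (\<alpha> i) + of_real (\<gamma> i) * z) * w))) (at z)"
        unfolding \<theta>_def
        by (intro has_derivative_sum has_derivative_mult_right has_derivative_Arg_affine that)
      also have "(\<lambda>w. \<Sum>i\<in>UNIV. a i * Im (of_real (\<gamma> i) / (of_real (\<alpha> i) + of_real (\<gamma> i) * z) * w)) =
          (\<lambda>w. Im (g a z * w))"
        unfolding g_def sum_distrib_right Im_sum
        by (intro ext sum.cong refl) (simp only: mult.assoc scale)
      finally show ?thesis .
    qed
    note d = this
    have "(f has_derivative (\<lambda>w. of_real (Im (g \<alpha> z * w)) + \<i> * of_real (Im (g \<gamma> z * w)))) (at z)"
      unfolding f by (intro derivative_intros has_derivative_of_real d)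
    also have "(\<lambda>w. of_real (Im (g \<alpha> z * w)) + \<i> * of_real (Im (g \<gamma> z * w))) =
        (\<lambda>w. Complex (Im (g \<alpha> z * w)) (Im (g \<gamma> z * w)))"
      by (simp add: complex_eq_iff fun_eq_iff)
    finally show ?thesis .
  qed
  obtain z where z: "Im z > 0" and gz: "g \<alpha> z \<noteq> 0"
    using exists_nonzero_log_derivative[OF ns] unfolding g_def by metis
  have horn: "g \<alpha> z = - z * g \<gamma> z"
  proof -
    have gen: "a * (b / l) + z * (b * (b / l)) = b * ((a + b * z) / l)" for a b l :: complex
      by (simp add: divide_inverse algebra_simps)
    have "g \<alpha> z + z * g \<gamma> z = (\<Sum>i\<in>UNIV. of_real (\<gamma> i))"
      unfolding g_def sum_distrib_left sum.distrib[symmetric]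
    proof (intro sum.cong refl)
      fix i
      let ?l = "of_real (\<alpha> i) + of_real (\<gamma> i) * z"
      have "?l \<noteq> 0 \<or> \<gamma> i = 0" using z by (auto simp: complex_eq_iff)
      then have "of_real (\<gamma> i) * (?l / ?l) = of_real (\<gamma> i)"
      proof
        assume "?l \<noteq> 0"
        then have "?l / ?l = 1" by (rule divide_self)
        then show ?thesis by (simp only: mult_1_right)
      qed simp
      then show "of_real (\<alpha> i) * (of_real (\<gamma> i) / ?l) + z * (of_real (\<gamma> i) * (of_real (\<gamma> i) / ?l)) =
          of_real (\<gamma> i)" by (rule trans[OF gen])
    qed
    also have "\<dots> = 0" using sum0 by (metis of_real_0 of_real_sum)
    finally show ?thesis by (simp add: eq_neg_iff_add_eq_0)
  qed
  \<comment> \<open>the inverse of the derivative: recover u from Im u and Im (- z u), then divide by the value of g\<close>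
  define h where "h w = Complex ((- Re w - Re z * Im w) / Im z) (Im w) / g \<gamma> z" for w
  have g0: "g \<gamma> z \<noteq> 0" using gz horn by auto
  have "f z \<in> interior (f ` {z. Im z > 0})"
  proof (rule sussmann_open_mapping[OF _ _ _ der])
    show "continuous_on {z. Im z > 0} f"
      by (rule has_derivative_continuous_on) (use der has_derivative_at_withinI in blast)
    have "linear (\<lambda>w. Complex ((- Re w - Re z * Im w) / Im z) (Im w))"
      by (intro linearI) (simp_all add: complex_eq_iff divide_inverse algebra_simps)
    then have "bounded_linear (\<lambda>w. Complex ((- Re w - Re z * Im w) / Im z) (Im w))"
      by (simp only: linear_conv_bounded_linear)
    then show "bounded_linear h"
      unfolding h_def by (rule bounded_linear_compose[OF bounded_linear_divide])
    show "(\<lambda>w. Complex (Im (g \<alpha> z * w)) (Im (g \<gamma> z * w))) \<circ> h = id"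
    proof
      fix w
      have "g \<gamma> z * h w = Complex ((- Re w - Re z * Im w) / Im z) (Im w)"
        using g0 by (simp add: h_def)
      moreover from this have "g \<alpha> z * h w = - z * Complex ((- Re w - Re z * Im w) / Im z) (Im w)"
        using horn by (simp add: mult.assoc)
      moreover have "Im z * ((- Re w - Re z * Im w) / Im z) = - Re w - Re z * Im w"
        using z by simp
      ultimately show "((\<lambda>w. Complex (Im (g \<alpha> z * w)) (Im (g \<gamma> z * w))) \<circ> h) w = id w"
        by (simp add: complex_eq_iff del: times_divide_eq_right)
    qed
  qed (use z open_halfspace_Im_gt[of 0] in \<open>auto simp: interior_open\<close>)
  then show ?thesis using that z by blast
qed

section \<open>Dimension of subsets of the torus\<close>

text \<open>The Taylor expansion of the identity around \<open>p\<close>: only the multi-index \<open>0\<close> and the \<open>d\<close> unit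
multi-indices carry a coefficient. The sum over \<open>j\<close> in \<open>c\<close> has at most one term; it selects the
basis vector of a unit multi-index and vanishes on all other ones.\<close>

lemma has_sum_linear_expansion:
  fixes x p :: "real ^ 'd::finite"
  defines "c \<equiv> \<lambda>e :: 'd \<Rightarrow> nat. if e = (\<lambda>_. 0) then p else
     (\<Sum>j | e = (\<lambda>i. if i = j then 1 else 0). axis j 1)"
  shows "((\<lambda>e. (\<Prod>j\<in>UNIV. (x $ j - p $ j) ^ e j) *\<^sub>R c e) has_sum x) UNIV"
proof -
  let ?\<delta> = "\<lambda>j i :: 'd. if i = j then 1 else 0 :: nat"
  let ?S = "insert (\<lambda>_. 0) (range ?\<delta>)"
  have inj: "j = k" if "?\<delta> j = ?\<delta> k" for j k
    using fun_cong[OF that, of j] by (simp split: if_splits)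
  have \<delta>0: "?\<delta> j \<noteq> (\<lambda>_. 0)" for j
    using fun_cong[of "?\<delta> j" "\<lambda>_. 0" j] by auto
  have c\<delta>: "c (?\<delta> j) = axis j 1" for j
  proof -
    have "{k. ?\<delta> j = ?\<delta> k} = {j}" using inj by blast
    then show ?thesis using \<delta>0[of j] by (simp add: c_def)
  qed
  have mono: "(\<Prod>i\<in>UNIV. (x $ i - p $ i) ^ ?\<delta> j i) = x $ j - p $ j" for j
    by (simp add: if_distrib[of "\<lambda>n. _ ^ n"] cong: if_cong)
  show ?thesis
  proof (rule has_sum_finite_neutralI[of ?S])
    show "(\<Prod>j\<in>UNIV. (x $ j - p $ j) ^ e j) *\<^sub>R c e = 0" if "e \<in> UNIV - ?S" for e
    proof -
      have "{j. e = ?\<delta> j} = {}" using that by auto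
      then show ?thesis using that by (simp add: c_def)
    qed
    have "(\<Sum>e\<in>?S. (\<Prod>j\<in>UNIV. (x $ j - p $ j) ^ e j) *\<^sub>R c e) =
        p + (\<Sum>e\<in>range ?\<delta>. (\<Prod>j\<in>UNIV. (x $ j - p $ j) ^ e j) *\<^sub>R c e)"
      by (subst sum.insert) (use \<delta>0[THEN not_sym] in \<open>auto simp: c_def\<close>)
    also have "(\<Sum>e\<in>range ?\<delta>. (\<Prod>j\<in>UNIV. (x $ j - p $ j) ^ e j) *\<^sub>R c e) =
        (\<Sum>j\<in>UNIV. (x $ j - p $ j) *\<^sub>R axis j 1)"
      by (subst sum.reindex) (auto intro!: injI inj simp: c\<delta> mono simp del: if_split)
    also have "\<dots> = x - p"
      by (simp add: vec_eq_iff axis_def if_distrib cong: if_cong)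
    finally show "x = (\<Sum>e\<in>?S. (\<Prod>j\<in>UNIV. (x $ j - p $ j) ^ e j) *\<^sub>R c e)" by simp
  qed auto
qed

text \<open>The identity on \<open>W\<close> is a chart for a submanifold of full dimension, and no submanifold has more
than \<open>d\<close> dimensions.\<close>

lemma torus_dim_eq_if_contains_open:
  fixes X :: "(complex ^ 'd::finite) set"
  assumes "open W" "W \<noteq> {}" "torus_exp ` W \<subseteq> X"
  shows "torus_dim X = CARD('d)"
proof -
  have "real_analytic_on W (\<lambda>x. x)"
    unfolding real_analytic_on_def
    by (intro ballI exI[of _ 1] conjI exI) (auto intro: has_sum_linear_expansion)
  moreover have "\<exists>f'. ((\<lambda>x. x) has_derivative f') (at x) \<and> inj f'" for x :: "real ^ 'd"
    using has_derivative_ident[of "at x"] inj_on_id2 by blast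
  ultimately have "contains_submanifold X CARD('d)"
    unfolding contains_submanifold_def
    using assms by (intro exI[of _ UNIV] exI[of _ W] exI[of _ "\<lambda>x. x"]) auto
  moreover have "k \<le> CARD('d)" if "contains_submanifold X k" for k
  proof -
    obtain V :: "(real ^ 'd) set" where "dim V = k"
      using \<open>contains_submanifold X k\<close> unfolding contains_submanifold_def by blast
    then show ?thesis using dim_subset_UNIV[of V] by simp
  qed
  ultimately show ?thesis
    unfolding torus_dim_def
    by (intro Max_eqI) (auto intro!: finite_subset[of _ "{..CARD('d)}"])
qed

section \<open>The stratum is a prism\<close>

lemma arr_compl_nonzero: "z \<in> arr_compl I B V \<Longrightarrow> i \<in> I \<Longrightarrow> z i \<noteq> 0"
  by (auto simp: arr_compl_def)

text \<open>\<open>E z\<close> is an exponent of the phase of the part of \<open>\<phi>\<^sub>B\<close> that comes from the restriction to \<open>L\<close>. For the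
inclusion of the prism, a phase \<open>t\<close> above the closed coamoeba agrees modulo the kernel torus with
a limit \<open>c\<close> of such phases, by compactness, and \<open>prism_in_stratum\<close> with \<open>m = j\<close> allows
the multiplication by any element of this torus.\<close>

lemma stratum_eq_prism:
  fixes B :: "'n::finite \<Rightarrow> int ^ 'd::finite" and q :: "int ^ 'd \<Rightarrow> int ^ 'k::finite"
  assumes "adapted_flag B F v" and j: "j < CARD('d)" "vec_flat B L = F j"
    and "flat_quotient B L q"
  shows "phase_stratum B L = {t \<in> utorus. torus_map q t \<in>
      closed_coamoeba (reduced_discriminant (- vec_flat B L) (\<lambda>i. q (B i)))}"
proof -
  interpret adapted_flag B F v by fact
  interpret flat_quotient B L q by fact
  let ?G = "- vec_flat B L"
  let ?R = "arr_compl ?G B L"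
  let ?X = "phi ?G (\<lambda>i. q (B i)) ` ?R"
  let ?D = "closed_coamoeba (reduced_discriminant ?G (\<lambda>i. q (B i)))"
  define E where "E z = (\<Sum>i\<in>?G. Arg (z i) *\<^sub>R real_vec (B i))" for z :: "'n \<Rightarrow> complex"
  have D: "?D = closure (arg_map ` ?X)"
  proof -
    have "?X \<subseteq> ctorus" using arr_compl_nonzero by (blast intro: phi_in_ctorus)
    note closure_X = closed_coamoeba_torus_closure[OF this]
    show ?thesis
      unfolding reduced_discriminant_def restricted_arrangement closure_X
      unfolding closed_coamoeba_def coamoeba_def ..
  qed
  have q0: "real_vec (q (B i)) = 0" if "i \<in> vec_flat B L" for i
  proof -
    have "q (B i) = 0" using mem_flat_perp[OF that] q_eq_0_iff by simp
    then show ?thesis by (simp add: vec_eq_iff)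
  qed
  have ext: "real_ext q (\<Sum>i\<in>I. c i *\<^sub>R real_vec (B i)) = (\<Sum>i\<in>I. c i *\<^sub>R real_vec (q (B i)))"
    for I and c :: "'n \<Rightarrow> real"
    by (simp only: linear_sum[OF linear_real_ext] linear_scale[OF linear_real_ext]
      real_ext_real_vec[of q, OF q_add])
  have pr_E: "torus_map q (torus_exp (E z)) = arg_map (phi ?G (\<lambda>i. q (B i)) z)" if "z \<in> ?R" for z
    unfolding torus_map_torus_exp E_def ext
    by (rule arg_map_phi_torus_exp[symmetric]) (use arr_compl_nonzero[OF that] in \<open>simp add: cis_Arg\<close>)
  show ?thesis
  proof (intro equalityI)
    have "closed ?D" by (simp add: closed_coamoeba_def)
    then have "closed (utorus \<inter> torus_map q -` ?D)"
      by (rule continuous_closed_preimage[OF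
        continuous_on_subset[OF continuous_on_torus_map utorus_subset_ctorus]
        compact_imp_closed[OF compact_utorus]])
    moreover have "arg_map ` phi UNIV B ` initial_compl B L \<subseteq> utorus \<inter> torus_map q -` ?D"
    proof clarify
      fix z assume z: "z \<in> initial_compl B L"
      have nz: "z i \<noteq> 0" for i
      proof (cases "i \<in> vec_flat B L")
        case True
        then show ?thesis
          using z arr_compl_nonzero[of "restrict z (vec_flat B L)" "vec_flat B L" B UNIV i]
          by (simp add: initial_compl_def)
      next
        case False
        then show ?thesis using z arr_compl_nonzero[of "restrict z ?G" ?G B L i]
          by (simp add: initial_compl_def)
      qed
      have zR: "restrict z ?G \<in> ?R" using z by (simp add: initial_compl_def)
      let ?x = "\<Sum>i\<in>UNIV. Arg (z i) *\<^sub>R real_vec (B i)"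
      have x: "arg_map (phi UNIV B z) = torus_exp ?x"
        by (rule arg_map_phi_torus_exp) (simp add: nz cis_Arg)
      have "real_ext q ?x = real_ext q (E (restrict z ?G))"
        unfolding ext E_def by (rule sum.mono_neutral_cong_right) (auto simp: q0)
      then have "torus_map q (torus_exp ?x) = arg_map (phi ?G (\<lambda>i. q (B i)) (restrict z ?G))"
        using pr_E[OF zR] by (simp add: torus_map_torus_exp)
      also have "\<dots> \<in> ?D"
        unfolding D using zR by (intro subsetD[OF closure_subset] imageI)
      finally show "arg_map (phi UNIV B z) \<in> utorus \<inter> torus_map q -` ?D"
        unfolding x by (simp add: torus_exp_in_utorus)
    qed
    ultimately have "phase_stratum B L \<subseteq> utorus \<inter> torus_map q -` ?D"
      unfolding phase_stratum_def closed_coamoeba_def[of "phi UNIV B ` _"] coamoeba_def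
      by (intro closure_minimal)
    then show "phase_stratum B L \<subseteq> {t \<in> utorus. torus_map q t \<in> ?D}" by auto
  next
    show "{t \<in> utorus. torus_map q t \<in> ?D} \<subseteq> phase_stratum B L"
    proof clarify
      fix t assume t: "t \<in> utorus" "torus_map q t \<in> ?D"
      let ?C = "closure ((\<lambda>z. torus_exp (E z)) ` ?R)"
      have C: "?C \<subseteq> utorus"
        by (rule closure_minimal) (auto simp: torus_exp_in_utorus compact_imp_closed compact_utorus)
      then have "compact ?C"
        using compact_Int_closed[OF compact_utorus, of ?C] by (simp add: Int_absorb1)
      then have "closed (torus_map q ` ?C)"
        by (intro compact_imp_closed compact_continuous_image
          continuous_on_subset[OF continuous_on_torus_map] subset_trans[OF C utorus_subset_ctorus])
      moreover have "arg_map ` ?X \<subseteq> torus_map q ` ?C"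
        using pr_E closure_subset[of "(\<lambda>z. torus_exp (E z)) ` ?R"] by (force simp: image_iff)
      ultimately have "?D \<subseteq> torus_map q ` ?C" unfolding D by (intro closure_minimal)
      then obtain c where c: "c \<in> ?C" "torus_map q t = torus_map q c" using t by blast
      obtain x y where "t = torus_exp x" "c = torus_exp y"
        using t(1) c(1) C utorus_eq_range_torus_exp by blast
      then obtain w where w: "w \<in> rspan B (F j)" "t = torus_exp w * c"
        using torus_map_fibre[of x y] c(2) j by (auto simp: torus_exp_add)
      have "torus_exp (w + E z) \<in> phase_stratum B L" if z: "z \<in> ?R" for z
      proof -
        obtain y where y: "y \<in> L" "\<forall>i\<in>?G. pairing (B i) y \<noteq> 0" "z = (\<lambda>i\<in>?G. pairing (B i) y)"
          using z by (auto simp: arr_compl_def)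
        show ?thesis
          unfolding E_def j(2)
        proof (rule prism_in_stratum[OF L j(2) order_refl j(1) _ _ _ w(1)])
          show "pairing (B k) y = 0" if "k \<in> F j" for k
            using that y(1) j(2) by (auto simp: vec_flat_def)
        qed (use y j(2) in \<open>auto simp: cis_Arg\<close>)
      qed
      then have "(\<lambda>s. torus_exp w * s) ` (\<lambda>z. torus_exp (E z)) ` ?R \<subseteq> phase_stratum B L"
        by (auto simp: torus_exp_add)
      then have "(\<lambda>s. torus_exp w * s) ` ?C \<subseteq> phase_stratum B L"
        by (intro image_closure_subset[OF _ closed_phase_stratum])
          (auto simp: times_vec_def intro!: continuous_intros)
      then show "t \<in> phase_stratum B L" using c(1) w(2) by blast
    qed
  qed
qed

section \<open>Strata of full dimension\<close>

text \<open>Pairing the relations between the vectors of \<open>A\<close> with the functional \<open>u\<close> that is \<open>1\<close> on \<open>A\<close> shows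
that the entries of a relation sum to zero; the coordinates of the vectors of \<open>B\<close> are such relations.\<close>

lemma gale_dual_sum_zero:
  assumes "configuration A" "gale_dual A B"
  shows "(\<Sum>i\<in>UNIV. B i) = 0"
proof -
  obtain u where u: "\<And>i. pairing (A i) u = (1::real)"
    using assms(1) by (auto simp: configuration_def)
  have "(\<Sum>i\<in>UNIV. B i $ j) = 0" for j
  proof -
    have "(\<chi> i. pairing (B i) (axis j 1)) \<in> relations A"
      using assms(2) by (auto simp: gale_dual_def bij_betw_def)
    moreover have "pairing (B i) (axis j 1) = B i $ j" for i
      by (simp add: pairing_def axis_def if_distrib cong: if_cong)
    ultimately have "(\<Sum>i\<in>UNIV. B i $ j *s A i) = 0" by (simp add: relations_def)
    then have "pairing (\<Sum>i\<in>UNIV. B i $ j *s A i) u = 0" by simp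
    then have "real_of_int (\<Sum>i\<in>UNIV. B i $ j) = 0"
      by (simp add: pairing_sum_left pairing_scale_left u)
    then show ?thesis by (simp only: of_int_eq_0_iff)
  qed
  then show ?thesis by (simp add: vec_eq_iff)
qed

context adapted_flag
begin

lemma orthogonal_to_last_flat:
  assumes i: "Suc i = CARD('d)" and r: "\<And>k. k \<in> F i \<Longrightarrow> real_vec (B k) \<bullet> r = 0"
  shows "\<exists>c. r = c *\<^sub>R v i"
proof -
  define x where "x = r - (r \<bullet> v i / (v i \<bullet> v i)) *\<^sub>R v i"
  have "x \<bullet> v i = 0" by (cases "v i = 0") (simp_all add: x_def inner_diff_left)
  moreover have "x \<in> rspan B (F (Suc i))" using spanning F_top i by simp
  ultimately have "x \<in> rspan B (F i)" using v_separates[of i x] i by simp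
  moreover have "real_vec (B k) \<bullet> x = 0" if "k \<in> F i" for k
    using r[OF that] v_kills[OF _ that] i by (simp add: x_def inner_diff_right)
  then have "w \<bullet> x = 0" if "w \<in> rspan B (F i)" for w
    using that by (rule_tac span_induct) (auto simp: subspace_def inner_add_left)
  ultimately have "x \<bullet> x = 0" by blast
  then show ?thesis by (auto simp: x_def)
qed

text \<open>By \<open>orthogonal_to_last_flat\<close> the real and the imaginary part of a point of the flat are multiples of
the last vector \<open>v j\<close>.\<close>

lemma flat_dim_le_1:
  assumes "Suc j = CARD('d)" "vec_flat B L = F j"
  shows "vec.dim L \<le> 1"
proof -
  have "y \<in> vec.span {complexify (v j)}" if y: "y \<in> L" for y
  proof -
    have "pairing (B k) y = 0" if "k \<in> F j" for k
      using that y assms(2) by (auto simp: vec_flat_def)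
    then have "real_vec (B k) \<bullet> (\<chi> j. Re (y $ j)) = 0" "real_vec (B k) \<bullet> (\<chi> j. Im (y $ j)) = 0"
      if "k \<in> F j" for k
      using that by (metis Re_pairing zero_complex.sel(1), metis Im_pairing zero_complex.sel(2))
    then obtain a b where "(\<chi> j. Re (y $ j)) = a *\<^sub>R v j" "(\<chi> j. Im (y $ j)) = b *\<^sub>R v j"
      using orthogonal_to_last_flat[OF assms(1)] by meson
    then have "y = Complex a b *s complexify (v j)"
      by (simp add: complexify_def vec_eq_iff complex_eq_iff)
    then show ?thesis by (simp add: vec.span_base vec.span_scale)
  qed
  then have "vec.dim L \<le> card {complexify (v j)}"
    by (intro vec.dim_le_card) auto
  then show ?thesis by simp
qed

text \<open>\<open>prism_in_stratum\<close> with \<open>m = d - 2\<close> leaves only two coordinates to control, \<open>x \<bullet> v m\<close> and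
\<open>x \<bullet> v (Suc m)\<close>. For \<open>y = v m + z v (Suc m)\<close> they are the two components of the map of
\<open>line_phases_have_interior\<close>. The hypothesis of that lemma on \<open>\<alpha>\<close> is the non-splitting condition for
the flat of rank \<open>d - 1\<close>, because \<open>\<gamma>\<close> vanishes exactly on this flat.\<close>

lemma stratum_contains_open:
  assumes sum0: "(\<Sum>k\<in>UNIV. real_vec (B k)) = 0"
    and L: "arr_flat B L" "vec_flat B L = F j" and m: "CARD('d) = Suc (Suc m)" "j \<le> m"
  obtains W where "open W" "W \<noteq> {}" "torus_exp ` W \<subseteq> phase_stratum B L"
proof -
  define \<alpha> where "\<alpha> k = real_vec (B k) \<bullet> v m" for k
  define \<gamma> where "\<gamma> k = real_vec (B k) \<bullet> v (Suc m)" for k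
  define \<theta> where "\<theta> z k = Arg (of_real (\<alpha> k) + of_real (\<gamma> k) * z)" for z k
  define f where "f z = Complex (\<Sum>k\<in>UNIV. \<alpha> k * \<theta> z k) (\<Sum>k\<in>UNIV. \<gamma> k * \<theta> z k)" for z
  have \<gamma>0: "\<gamma> k = 0 \<longleftrightarrow> k \<in> F (Suc m)" for k
    using v_kills[of "Suc m" k] v_detects[of "Suc m" k] F_top m(1) by (auto simp: \<gamma>_def)
  have \<alpha>0: "\<alpha> k = 0" if "k \<in> F m" for k
    using v_kills[OF _ that] m(1) by (simp add: \<alpha>_def)
  have F_sub: "F m \<subseteq> F (Suc m)" using F_step m(1) by simp
  have "(\<Sum>k\<in>UNIV. \<alpha> k) = 0" "(\<Sum>k\<in>UNIV. \<gamma> k) = 0"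
    using sum0 by (simp_all add: \<alpha>_def \<gamma>_def flip: inner_sum_left)
  moreover have "(\<Sum>k | \<gamma> k = 0. \<alpha> k) \<noteq> 0"
    using v_sum[of m] m(1) by (simp add: \<gamma>0 \<alpha>_def inner_sum_left)
  moreover have f_eq: "f = (\<lambda>z. Complex (\<Sum>k\<in>UNIV. \<alpha> k * Arg (of_real (\<alpha> k) + of_real (\<gamma> k) * z))
      (\<Sum>k\<in>UNIV. \<gamma> k * Arg (of_real (\<alpha> k) + of_real (\<gamma> k) * z)))"
    by (simp add: fun_eq_iff f_def \<theta>_def)
  ultimately obtain z0 where z0: "Im z0 > 0" "f z0 \<in> interior (f ` {z. Im z > 0})"
    using line_phases_have_interior[of \<gamma> \<alpha>, folded f_eq] by metis
  define W where "W = (\<lambda>x. Complex (x \<bullet> v m) (x \<bullet> v (Suc m))) -` interior (f ` {z. Im z > 0})"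
  show ?thesis
  proof (rule that[of W])
    show "open W"
      unfolding W_def Complex_eq by (intro open_vimage open_interior continuous_intros)
    have "Complex ((\<Sum>k\<in>UNIV. \<theta> z0 k *\<^sub>R real_vec (B k)) \<bullet> v m)
        ((\<Sum>k\<in>UNIV. \<theta> z0 k *\<^sub>R real_vec (B k)) \<bullet> v (Suc m)) = f z0"
      by (simp add: f_def \<alpha>_def \<gamma>_def inner_sum_left mult.commute)
    then show "W \<noteq> {}" using z0(2) unfolding W_def by blast
    show "torus_exp ` W \<subseteq> phase_stratum B L"
    proof clarify
      fix x assume "x \<in> W"
      then obtain z where z: "Im z > 0" and x: "Complex (x \<bullet> v m) (x \<bullet> v (Suc m)) = f z"
        using interior_subset unfolding W_def by blast
      \<comment> \<open>x and the phase at z agree in both coordinates, hence they agree modulo the span of F m\<close>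
      define X where "X = (\<Sum>k\<in>- F m. \<theta> z k *\<^sub>R real_vec (B k))"
      have "X \<bullet> v m = (\<Sum>k\<in>- F m. \<alpha> k * \<theta> z k)" "X \<bullet> v (Suc m) = (\<Sum>k\<in>- F m. \<gamma> k * \<theta> z k)"
        by (simp_all add: X_def \<alpha>_def \<gamma>_def inner_sum_left mult.commute)
      moreover have "(\<Sum>k\<in>- F m. \<alpha> k * \<theta> z k) = (\<Sum>k\<in>UNIV. \<alpha> k * \<theta> z k)"
        by (rule sum.mono_neutral_left) (auto simp: \<alpha>0)
      moreover have "(\<Sum>k\<in>- F m. \<gamma> k * \<theta> z k) = (\<Sum>k\<in>UNIV. \<gamma> k * \<theta> z k)"
        by (rule sum.mono_neutral_left) (use \<gamma>0 F_sub in auto)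
      ultimately have perp: "(x - X) \<bullet> v m = 0" "(x - X) \<bullet> v (Suc m) = 0"
        using x by (simp_all add: f_def inner_diff_left)
      have "x - X \<in> rspan B (F (Suc (Suc m)))" using spanning F_top m(1) by simp
      then have "x - X \<in> rspan B (F m)"
        using v_separates perp m(1) by simp
      then have "torus_exp (x - X + X) \<in> phase_stratum B L"
        unfolding X_def
      proof (rule prism_in_stratum[OF L m(2), where y = "complexify (v m) + z *s complexify (v (Suc m))", rotated -1])
        have pair: "pairing (B k) (complexify (v m) + z *s complexify (v (Suc m))) =
            of_real (\<alpha> k) + of_real (\<gamma> k) * z" for k
          by (simp add: pairing_add_right pairing_scale_right pairing_complexify \<alpha>_def \<gamma>_def mult.commute)
        show "pairing (B k) (complexify (v m) + z *s complexify (v (Suc m))) = 0" if "k \<in> F m" for k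
          unfolding pair using \<alpha>0[OF that] \<gamma>0[of k] F_sub that by auto
        show nz: "pairing (B k) (complexify (v m) + z *s complexify (v (Suc m))) \<noteq> 0" if "k \<notin> F m" for k
          unfolding pair using v_detects[of m k] that \<gamma>0[of k] z m(1)
          by (auto simp: complex_eq_iff \<alpha>_def[symmetric])
        show "sgn (pairing (B k) (complexify (v m) + z *s complexify (v (Suc m)))) = cis (\<theta> z k)"
          if "k \<notin> F m" for k
          using nz[OF that] unfolding pair \<theta>_def by (simp add: cis_Arg)
      qed (use m(1) in simp)
      then show "torus_exp x \<in> phase_stratum B L" by simp
    qed
  qed
qed

end

theorem theorem4p8:
  fixes A :: "'n::finite \<Rightarrow> int ^ 'm::finite"
    and B :: "'n \<Rightarrow> int ^ 'd::finite"
    and L :: "(complex ^ 'd) set"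
  assumes "CARD('d) > 2"
    and "CARD('n) = CARD('m) + CARD('d)"
    and "configuration A"
    and "gale_dual A B"
    and "\<forall>i. B i \<noteq> 0"
    and "nondefective A"
    and "nonsplitting_flat B L"
  shows "(\<forall>q :: int ^ 'd \<Rightarrow> int ^ ('k::finite). lattice_quotient q (flat_perp B L) \<longrightarrow>
            phase_stratum B L =
              {t \<in> utorus. torus_map q t \<in>
                 closed_coamoeba (reduced_discriminant (- vec_flat B L) (\<lambda>i. q (B i)))}) \<and>
         (vec.dim L > 1 \<longrightarrow> torus_dim (phase_stratum B L) = CARD('d))"
proof (intro conjI allI impI)
  obtain F j where L: "arr_flat B L" and F: "nonsplitting_flag B F"
    and j: "j < CARD('d)" "vec_flat B L = F j"
    using assms(7) by (auto simp: nonsplitting_flat_def)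
  obtain v where v: "adapted_flag B F v" by (rule nonsplitting_flag_adapted[OF F])
  interpret adapted_flag B F v by (rule v)
  show "phase_stratum B L = {t \<in> utorus. torus_map q t \<in>
      closed_coamoeba (reduced_discriminant (- vec_flat B L) (\<lambda>i. q (B i)))}"
    if "lattice_quotient q (flat_perp B L)" for q :: "int ^ 'd \<Rightarrow> int ^ 'k"
    by (rule stratum_eq_prism[OF v j]) (unfold_locales, use L that in auto)
  show "torus_dim (phase_stratum B L) = CARD('d)" if "vec.dim L > 1"
  proof -
    have "Suc j \<noteq> CARD('d)" using flat_dim_le_1[OF _ j(2)] that by auto
    then obtain m where m: "CARD('d) = Suc (Suc m)" "j \<le> m"
      using j(1) by (metis Suc_leI Suc_lessI less_Suc_eq_le less_imp_Suc_add not0_implies_Suc Suc_less_eq2)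
    have "(\<Sum>k\<in>UNIV. real_vec (B k)) = 0"
      using gale_dual_sum_zero[OF assms(3,4)] by (simp add: vec_eq_iff flip: real_vec_sum)
    then obtain W where "open W" "W \<noteq> {}" "torus_exp ` W \<subseteq> phase_stratum B L"
      using stratum_contains_open[OF _ L j(2) m] by blast
    then show ?thesis by (rule torus_dim_eq_if_contains_open)
  qed
qed

end
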